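(* Let $G$ be a connected Lie group that is Lie contractible and has an almost effective smooth action on the sphere $\mathbf{S}^{n-1}$, where $n\ge 1$. Then on every topological $n$-manifold $M^n$ there is an effective action of $G$ which is the identity outside a coordinate ball, and which is smooth if $M^n$ is smooth.
   Context: A topological manifold is a connected locally Euclidean metric space (possibly with boundary). An action $\alpha$ of a Lie group $G$ on $M$ is a homomorphism $g\mapsto g^\alpha$ from $G$ to the group of homeomorphisms of $M$ with continuous evaluation map $G\times M\to M$, $(g,x)\mapsto g^\alpha(x)$; it is smooth if the evaluation map is $C^\infty$. It is effective if the kernel of $g\mapsto g^\alpha$ is trivial, and almost effective if this kernel is discrete. A Lie group $G$ is Lie contractible if there is a family $\{\theta_t\}_{t\in\mathbb{R}}$ of Lie group endomorphisms $\theta_t\colon G\to G$ such that $\theta_t$ is the identity for $t\le 0$, $\theta_t=\theta_1$ for $t\ge 1$, the map $\mathbb{R}\times G\to G$, $(t,g)\mapsto\theta_t(g)$, is $C^\infty$, and $\theta_1$ is the trivial endomorphism. A coordinate ball in $M^n$ is a subset corresponding to a closed ball of $\mathbb{R}^n$ under a coordinate chart (a smooth chart when $M^n$ is smooth). *)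

theory Defs
  imports "HOL-Analysis.Analysis" "HOL-Algebra.Group_Action"
begin

section \<open>Smooth maps between subsets of Euclidean spaces\<close>

text \<open>
  Meaningful for open \<open>S\<close> only. In finite dimension, \<open>f\<close> is $C^{k+1}$ on \<open>S\<close> iff it is
  differentiable on \<open>S\<close> and every directional derivative is $C^k$ on \<open>S\<close>.
\<close>

primrec Ck_on_open :: "nat \<Rightarrow> 'a::euclidean_space set \<Rightarrow> ('a \<Rightarrow> 'b::euclidean_space) \<Rightarrow> bool" where
  "Ck_on_open 0 S f \<longleftrightarrow> continuous_on S f"
| "Ck_on_open (Suc k) S f \<longleftrightarrow>
     (\<forall>x\<in>S. f differentiable (at x)) \<and>
     (\<forall>v. Ck_on_open k S (\<lambda>x. frechet_derivative f (at x) v))"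

text \<open>
  On an arbitrary set \<open>S\<close> (a relatively open subset of a half-space or of a linear subspace, a
  sphere, or a product of such sets), smooth means: locally the restriction of a $C^\infty$ map
  defined on an open subset of the ambient space.
\<close>

definition smooth_on :: "'a::euclidean_space set \<Rightarrow> ('a \<Rightarrow> 'b::euclidean_space) \<Rightarrow> bool" where
  "smooth_on S f \<longleftrightarrow>
     (\<forall>x\<in>S. \<exists>U h. open U \<and> x \<in> U \<and> (\<forall>k. Ck_on_open k U h) \<and> (\<forall>y\<in>U \<inter> S. h y = f y))"


section \<open>Charts and atlases\<close>

text \<open>
  A chart is a pair of its domain and the coordinate map; only the values of the coordinate map
  on the domain matter. The parameter \<open>Ms\<close> is the set of admissible model spaces: a chart maps its
  domain homeomorphically onto a relatively open subset of one of them.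
\<close>

type_synonym ('a, 'e) atlas = "('a set \<times> ('a \<Rightarrow> 'e)) set"

definition charts :: "'e::euclidean_space set set \<Rightarrow> 'a topology \<Rightarrow> ('a, 'e) atlas" where
  "charts Ms X =
     {(U, \<phi>). openin X U \<and> (\<exists>H\<in>Ms. openin (top_of_set H) (\<phi> ` U)) \<and>
        homeomorphic_map (subtopology X U) (top_of_set (\<phi> ` U)) \<phi>}"

definition smooth_transition ::
  "'a set \<times> ('a \<Rightarrow> 'e::euclidean_space) \<Rightarrow> 'a set \<times> ('a \<Rightarrow> 'e) \<Rightarrow> bool" where
  "smooth_transition = (\<lambda>(U, \<phi>) (V, \<psi>). smooth_on (\<phi> ` (U \<inter> V)) (\<psi> \<circ> inv_into U \<phi>))"

definition smooth_atlas ::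
  "'e::euclidean_space set set \<Rightarrow> 'a topology \<Rightarrow> ('a, 'e) atlas \<Rightarrow> bool" where
  "smooth_atlas Ms X A \<longleftrightarrow>
     A \<subseteq> charts Ms X \<and> (\<Union>c\<in>A. fst c) = topspace X \<and>
     (\<forall>c\<in>A. \<forall>d\<in>A. smooth_transition c d)"

text \<open>The smooth charts form the maximal atlas determined by \<open>A\<close>.\<close>

definition smooth_charts ::
  "'e::euclidean_space set set \<Rightarrow> 'a topology \<Rightarrow> ('a, 'e) atlas \<Rightarrow> ('a, 'e) atlas" where
  "smooth_charts Ms X A =
     {c \<in> charts Ms X. \<forall>d\<in>A. smooth_transition c d \<and> smooth_transition d c}"

definition prod_atlas ::
  "('a, 'e) atlas \<Rightarrow> ('b, 'f) atlas \<Rightarrow> ('a \<times> 'b, 'e \<times> 'f) atlas" where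
  "prod_atlas A B = {(U \<times> V, map_prod \<phi> \<psi>) | U \<phi> V \<psi>. (U, \<phi>) \<in> A \<and> (V, \<psi>) \<in> B}"

text \<open>
  The smooth structure that a submanifold \<open>S\<close> inherits from the ambient Euclidean space. It is
  encoded by the inclusion, used as a single generalised chart, so that smoothness of maps from
  or to \<open>S\<close> becomes \<^const>\<open>smooth_on\<close> for the corresponding maps from or to the ambient space.
\<close>

definition submanifold_atlas :: "'e set \<Rightarrow> ('e, 'e) atlas" where
  "submanifold_atlas S = {(S, \<lambda>x. x)}"

definition smooth_map ::
  "'a topology \<Rightarrow> ('a, 'e::euclidean_space) atlas \<Rightarrow>
   'b topology \<Rightarrow> ('b, 'f::euclidean_space) atlas \<Rightarrow> ('a \<Rightarrow> 'b) \<Rightarrow> bool" where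
  "smooth_map X A Y B f \<longleftrightarrow>
     continuous_map X Y f \<and>
     (\<forall>(U, \<phi>)\<in>A. \<forall>(V, \<psi>)\<in>B. smooth_on (\<phi> ` {x \<in> U. f x \<in> V}) (\<psi> \<circ> f \<circ> inv_into U \<phi>))"


section \<open>Manifolds, possibly with boundary\<close>

definition boundary_models :: "(real ^ 'n) set set" where
  "boundary_models = insert UNIV {{x. 0 \<le> x $ k} | k. True}"

text \<open>
  The dimension is \<open>CARD('n)\<close>. Manifolds are nonempty: connectedness is understood to include this.
\<close>

definition topological_manifold :: "'n::finite itself \<Rightarrow> 'm topology \<Rightarrow> bool" where
  "topological_manifold n X \<longleftrightarrow>
     metrizable_space X \<and> connected_space X \<and> topspace X \<noteq> {} \<and>
     (\<forall>x\<in>topspace X. \<exists>c\<in>charts (boundary_models :: (real ^ 'n) set set) X. x \<in> fst c)"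

definition coordinate_ball :: "('m, 'e::euclidean_space) atlas \<Rightarrow> 'm set \<Rightarrow> bool" where
  "coordinate_ball C B \<longleftrightarrow>
     (\<exists>(U, \<phi>)\<in>C. \<exists>a r. 0 < r \<and> cball a r \<subseteq> \<phi> ` U \<and> B = {x \<in> U. \<phi> x \<in> cball a r})"


section \<open>Lie groups\<close>

text \<open>
  The charts of a Lie group take values in a linear subspace \<open>V\<close> of a Euclidean space rather than
  in the whole space, because types of class \<^class>\<open>euclidean_space\<close> have positive dimension and
  Lie groups of dimension 0 are to be included.
\<close>

definition lie_group ::
  "('g, 'x) monoid_scheme \<Rightarrow> 'g topology \<Rightarrow> ('g, 'k::euclidean_space) atlas \<Rightarrow> bool" where
  "lie_group G T A \<longleftrightarrow>
     group G \<and> topspace T = carrier G \<and> metrizable_space T \<and>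
     (\<exists>V. subspace V \<and> smooth_atlas {V} T A) \<and>
     smooth_map (prod_topology T T) (prod_atlas A A) T A (\<lambda>(g, h). g \<otimes>\<^bsub>G\<^esub> h) \<and>
     smooth_map T A T A (m_inv G)"

definition lie_contractible ::
  "('g, 'x) monoid_scheme \<Rightarrow> 'g topology \<Rightarrow> ('g, 'k::euclidean_space) atlas \<Rightarrow> bool" where
  "lie_contractible G T A \<longleftrightarrow>
     (\<exists>\<theta> :: real \<Rightarrow> 'g \<Rightarrow> 'g.
        (\<forall>t. \<theta> t \<in> hom G G \<and> smooth_map T A T A (\<theta> t)) \<and>
        (\<forall>t\<le>0. \<forall>g\<in>carrier G. \<theta> t g = g) \<and>
        (\<forall>t\<ge>1. \<forall>g\<in>carrier G. \<theta> t g = \<theta> 1 g) \<and>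
        smooth_map (prod_topology euclideanreal T) (prod_atlas (submanifold_atlas UNIV) A) T A
          (\<lambda>(t, g). \<theta> t g) \<and>
        (\<forall>g\<in>carrier G. \<theta> 1 g = \<one>\<^bsub>G\<^esub>))"


section \<open>Actions\<close>

definition top_action ::
  "('g, 'x) monoid_scheme \<Rightarrow> 'g topology \<Rightarrow> 'm topology \<Rightarrow> ('g \<Rightarrow> 'm \<Rightarrow> 'm) \<Rightarrow> bool" where
  "top_action G T X \<alpha> \<longleftrightarrow>
     group_action G (topspace X) \<alpha> \<and>
     (\<forall>g\<in>carrier G. homeomorphic_map X X (\<alpha> g)) \<and>
     continuous_map (prod_topology T X) X (\<lambda>(g, x). \<alpha> g x)"

definition smooth_action ::
  "('g, 'x) monoid_scheme \<Rightarrow> 'g topology \<Rightarrow> ('g, 'k::euclidean_space) atlas \<Rightarrow>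
   'm topology \<Rightarrow> ('m, 'e::euclidean_space) atlas \<Rightarrow> ('g \<Rightarrow> 'm \<Rightarrow> 'm) \<Rightarrow> bool" where
  "smooth_action G T A X AM \<alpha> \<longleftrightarrow>
     top_action G T X \<alpha> \<and>
     smooth_map (prod_topology T X) (prod_atlas A AM) X AM (\<lambda>(g, x). \<alpha> g x)"

definition effective ::
  "('g, 'x) monoid_scheme \<Rightarrow> 'm topology \<Rightarrow> ('g \<Rightarrow> 'm \<Rightarrow> 'm) \<Rightarrow> bool" where
  "effective G X \<alpha> \<longleftrightarrow> kernel G (BijGroup (topspace X)) \<alpha> = {\<one>\<^bsub>G\<^esub>}"

definition almost_effective ::
  "('g, 'x) monoid_scheme \<Rightarrow> 'g topology \<Rightarrow> 'm topology \<Rightarrow> ('g \<Rightarrow> 'm \<Rightarrow> 'm) \<Rightarrow> bool" where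
  "almost_effective G T X \<alpha> \<longleftrightarrow>
     (let K = kernel G (BijGroup (topspace X)) \<alpha> in subtopology T K = discrete_topology K)"

definition identity_outside ::
  "('g, 'x) monoid_scheme \<Rightarrow> 'm topology \<Rightarrow> ('g \<Rightarrow> 'm \<Rightarrow> 'm) \<Rightarrow> 'm set \<Rightarrow> bool" where
  "identity_outside G X \<alpha> B \<longleftrightarrow> (\<forall>g\<in>carrier G. \<forall>x\<in>topspace X - B. \<alpha> g x = x)"

end

(* Let the contraction \<theta> depend on the radius: g acts on the sphere of radius |v| by
   \<theta> s(|v|) g, where s \<ge> 1 near the origin and near the unit sphere, while s takes every value in
   [0, 1] in between. As \<theta> t is trivial for t \<ge> 1, the action is the identity near the origin and
   near and outside the unit sphere, hence smooth, and extends through a chart by the identity.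
   It is effective: if g acts trivially, then t \<mapsto> \<theta> t g is a path in the discrete kernel of \<beta> from g
   to the identity, and a path in a discrete space is constant. *)
theory Submission
  imports Defs
begin


section \<open>Calculus of smooth maps\<close>

text \<open>The plain cone \<open>norm v *\<^sub>R \<beta> g (sgn v)\<close> over a sphere action is
  already a continuous action on Euclidean space. In general, however, it is not smooth at the
  origin and not trivial far out. Letting the endomorphism vary with the radius cures both defects
  at once. The result is still an action for two reasons: every \<open>\<theta> t\<close> is a
  homomorphism, and spheres about the origin are invariant, so all factors of a product are applied
  with the same parameter. Since \<open>\<theta>\<close> stays trivial for all parameters beyond 1,
  a polynomial in the squared radius can take the place of a bump function: the square of an affine
  function of it has a zero inside the ball and is large on both sides. Away from the origin the
  formula is a composite of smooth maps; near the origin it is replaced by the identity. This split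
  reappears in the continuity proof and in the smoothness proof.\<close>

lemma Ck_on_open_subset: "Ck_on_open k S f \<Longrightarrow> T \<subseteq> S \<Longrightarrow> Ck_on_open k T f"
  by (induction k arbitrary: f) (auto intro: continuous_on_subset)

lemma Ck_on_open_SucD:
  assumes "Ck_on_open (Suc k) S f" "x \<in> S"
  shows "(f has_derivative frechet_derivative f (at x)) (at x)"
  using assms by (simp add: frechet_derivative_works)

text \<open>On an open set the values of a function determine its derivatives, so the agreement is
  inherited by all directional derivatives and the induction runs.\<close>

lemma Ck_on_open_cong:
  assumes "open S" "\<And>x. x \<in> S \<Longrightarrow> f x = g x" "Ck_on_open k S f"
  shows "Ck_on_open k S g"
  using assms(2,3)
proof (induction k arbitrary: f g)
  case 0
  then show ?case by (simp cong: continuous_on_cong)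
next
  case (Suc k)
  have D: "(g has_derivative frechet_derivative f (at x)) (at x)" if "x \<in> S" for x
    using Ck_on_open_SucD[OF Suc.prems(2) that] assms(1) that
    by (rule has_derivative_transform_within_open) (use Suc.prems(1) in auto)
  have eq: "frechet_derivative f (at x) v = frechet_derivative g (at x) v" if "x \<in> S" for x v
    using frechet_derivative_at[OF D[OF that]] by simp
  have "Ck_on_open k S (\<lambda>x. frechet_derivative g (at x) v)" for v
    by (rule Suc.IH[where f="\<lambda>x. frechet_derivative f (at x) v"]) (use eq Suc.prems(2) in auto)
  then show ?case
    using D by (auto simp: differentiable_def)
qed

text \<open>Derivatives are unique, so an explicit formula \<open>f'\<close> may stand for
  \<open>frechet_derivative\<close>. The closure rules below all enter the recursion this
  way.\<close>

lemma Ck_on_open_SucI: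
  assumes "open S" "\<And>x. x \<in> S \<Longrightarrow> (f has_derivative f' x) (at x)"
    "\<And>v. Ck_on_open k S (\<lambda>x. f' x v)"
  shows "Ck_on_open (Suc k) S f"
proof -
  have "Ck_on_open k S (\<lambda>x. frechet_derivative f (at x) v)" for v
    by (rule Ck_on_open_cong[OF assms(1) _ assms(3)]) (use frechet_derivative_at[OF assms(2)] in simp)
  then show ?thesis
    using assms(2) by (auto simp: differentiable_def)
qed

text \<open>The recursion at \<open>Suc k\<close> speaks only of the derivatives, so descent in the
  order has to be proved: differentiability gives continuity at the bottom, and above that the
  induction hypothesis is applied to each directional derivative.\<close>

lemma Ck_on_open_Suc_imp: "Ck_on_open (Suc k) S f \<Longrightarrow> Ck_on_open k S f"
proof (induction k arbitrary: f)
  case 0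
  then show ?case
    by (auto intro!: continuous_at_imp_continuous_on differentiable_imp_continuous_within)
next
  case (Suc k)
  then show ?case by (subst Ck_on_open.simps) (metis Ck_on_open.simps(2))
qed

lemma Ck_on_open_imp_continuous_on: "Ck_on_open k S f \<Longrightarrow> continuous_on S f"
proof (induction k arbitrary: f)
  case (Suc k)
  then show ?case using Ck_on_open_Suc_imp by blast
qed auto

lemma Ck_on_open_const: "Ck_on_open k S (\<lambda>x. c)"
  by (induction k arbitrary: c) auto

lemma Ck_on_open_bounded_linear:
  assumes "open S" "bounded_linear f"
  shows "Ck_on_open k S f"
proof (cases k)
  case 0
  then show ?thesis using assms by (simp add: linear_continuous_on)
next
  case (Suc j)
  show ?thesis unfolding Suc
    by (rule Ck_on_open_SucI[OF assms(1), where f'="\<lambda>_. f"])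
      (auto intro: bounded_linear_imp_has_derivative assms(2) Ck_on_open_const)
qed

lemma Ck_on_open_add:
  assumes "open S"
  shows "Ck_on_open k S f \<Longrightarrow> Ck_on_open k S g \<Longrightarrow> Ck_on_open k S (\<lambda>x. f x + g x)"
proof (induction k arbitrary: f g)
  case 0
  then show ?case by (simp add: continuous_on_add)
next
  case (Suc k)
  show ?case
    by (rule Ck_on_open_SucI[OF assms has_derivative_add[OF Ck_on_open_SucD[OF Suc.prems(1)]
            Ck_on_open_SucD[OF Suc.prems(2)]]])
      (use Suc in auto)
qed

lemma Ck_on_open_sum:
  assumes "open S" "\<And>i. i \<in> I \<Longrightarrow> Ck_on_open k S (f i)"
  shows "Ck_on_open k S (\<lambda>x. \<Sum>i\<in>I. f i x)"
  using assms(2)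
  by (induction I rule: infinite_finite_induct)
    (auto intro: Ck_on_open_const Ck_on_open_add[OF assms(1)])

text \<open>By the product rule the derivative consists of products of one factor with a derivative
  of the other, all of order \<open>k\<close>. Inner product, scaling and multiplication are covered
  together.\<close>

lemma Ck_on_open_bilinear:
  assumes "open S" "bounded_bilinear prd"
  shows "Ck_on_open k S f \<Longrightarrow> Ck_on_open k S g \<Longrightarrow> Ck_on_open k S (\<lambda>x. prd (f x) (g x))"
proof (induction k arbitrary: f g)
  case 0
  then show ?case by (simp add: bounded_bilinear.continuous_on[OF assms(2)])
next
  case (Suc k)
  have D: "Ck_on_open k S (\<lambda>x. frechet_derivative f (at x) v)"
    "Ck_on_open k S (\<lambda>x. frechet_derivative g (at x) v)" for v
    using Suc.prems by auto
  have "Ck_on_open k S (\<lambda>x. prd (f x) (frechet_derivative g (at x) v) + prd (frechet_derivative f (at x) v) (g x))" for v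
    by (rule Ck_on_open_add[OF assms(1) Suc.IH[OF Ck_on_open_Suc_imp[OF Suc.prems(1)] D(2)]
          Suc.IH[OF D(1) Ck_on_open_Suc_imp[OF Suc.prems(2)]]])
  then show ?case
    by (rule Ck_on_open_SucI[OF assms(1), rotated])
      (rule bounded_bilinear.FDERIV[OF assms(2) Ck_on_open_SucD[OF Suc.prems(1)] Ck_on_open_SucD[OF Suc.prems(2)]])
qed

text \<open>The chain rule applies the derivative of \<open>g\<close> to the direction
  \<open>frechet_derivative f (at x) v\<close>, which varies with \<open>x\<close>, while the
  recursion controls fixed directions only. Expanding that direction in \<open>Basis\<close> leaves
  fixed directions with scalar coefficients of order \<open>k\<close>.\<close>

lemma Ck_on_open_compose:
  assumes "open S" "open T"
  shows "Ck_on_open k S f \<Longrightarrow> Ck_on_open k T g \<Longrightarrow> f ` S \<subseteq> T \<Longrightarrow> Ck_on_open k S (\<lambda>x. g (f x))"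
proof (induction k arbitrary: g)
  case 0
  then show ?case by (auto intro: continuous_on_compose2)
next
  case (Suc k)
  let ?Df = "\<lambda>x. frechet_derivative f (at x)" and ?Dg = "\<lambda>y. frechet_derivative g (at y)"
  have Dg: "(g has_derivative ?Dg (f x)) (at (f x))" if "x \<in> S" for x
    using Ck_on_open_SucD[OF Suc.prems(2)] Suc.prems(3) that by blast
  show ?case
  proof (rule Ck_on_open_SucI[OF assms(1)])
    fix x assume x: "x \<in> S"
    show "((\<lambda>x. g (f x)) has_derivative (\<lambda>v. \<Sum>b\<in>Basis. (?Df x v \<bullet> b) *\<^sub>R ?Dg (f x) b)) (at x)"
    proof -
      have L: "linear (?Dg (f x))"
        using Dg[OF x] by (rule has_derivative_linear)
      have "?Dg (f x) (\<Sum>b\<in>Basis. (u \<bullet> b) *\<^sub>R b) = (\<Sum>b\<in>Basis. (u \<bullet> b) *\<^sub>R ?Dg (f x) b)" for u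
        by (simp only: linear_sum[OF L] linear_cmul[OF L])
      then have "?Dg (f x) u = (\<Sum>b\<in>Basis. (u \<bullet> b) *\<^sub>R ?Dg (f x) b)" for u
        unfolding euclidean_representation .
      then have "(\<lambda>v. ?Dg (f x) (?Df x v)) = (\<lambda>v. \<Sum>b\<in>Basis. (?Df x v \<bullet> b) *\<^sub>R ?Dg (f x) b)"
        by (rule ext)
      then show ?thesis
        using has_derivative_compose[OF Ck_on_open_SucD[OF Suc.prems(1) x] Dg[OF x]] by (simp only:)
    qed
  next
    fix v
    have D: "Ck_on_open k S (\<lambda>x. ?Df x v)" "\<And>b. Ck_on_open k T (\<lambda>y. ?Dg y b)"
      using Suc.prems by auto
    have "Ck_on_open k S (\<lambda>x. ?Df x v \<bullet> b)" for b
      by (rule Ck_on_open_bilinear[OF assms(1) bounded_bilinear_inner D(1) Ck_on_open_const])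
    moreover have "Ck_on_open k S (\<lambda>x. ?Dg (f x) b)" for b
      by (rule Suc.IH[OF Ck_on_open_Suc_imp[OF Suc.prems(1)] D(2) Suc.prems(3)])
    ultimately have "Ck_on_open k S (\<lambda>x. (?Df x v \<bullet> b) *\<^sub>R ?Dg (f x) b)" for b
      by (rule Ck_on_open_bilinear[OF assms(1) bounded_bilinear_scaleR])
    then show "Ck_on_open k S (\<lambda>x. \<Sum>b\<in>Basis. (?Df x v \<bullet> b) *\<^sub>R ?Dg (f x) b)"
      by (rule Ck_on_open_sum[OF assms(1)])
  qed
qed

text \<open>The derivative is a polynomial in \<open>inverse\<close> itself, so order
  \<open>k\<close> yields order \<open>Suc k\<close>.\<close>

lemma Ck_on_open_inverse: "Ck_on_open k (- {0}) (inverse :: real \<Rightarrow> real)"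
proof (induction k)
  case 0
  then show ?case by (auto intro!: continuous_intros)
next
  case (Suc k)
  have o: "open (- {0::real})" by auto
  show ?case
  proof (rule Ck_on_open_SucI[OF o])
    show "(inverse has_derivative (\<lambda>v. inverse x * inverse x * (- v))) (at x)" if "x \<in> - {0}" for x :: real
      using has_derivative_inverse'[of x UNIV] that by (simp add: algebra_simps)
    show "Ck_on_open k (- {0}) (\<lambda>x. inverse x * inverse x * (- v))" for v :: real
      by (rule Ck_on_open_bilinear[OF o bounded_bilinear_mult
            Ck_on_open_bilinear[OF o bounded_bilinear_mult Suc Suc] Ck_on_open_const])
  qed
qed

text \<open>The gradient at \<open>x\<close> is \<open>x\<close> divided by \<open>norm x\<close>,
  so the derivative is again expressed through the norm and the induction feeds itself.\<close>

lemma Ck_on_open_norm: "Ck_on_open k (- {0}) (norm :: 'a::euclidean_space \<Rightarrow> real)"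
proof (induction k)
  case 0
  then show ?case by (auto intro!: continuous_intros)
next
  case (Suc k)
  have o: "open (- {0::'a})" by auto
  show ?case
  proof (rule Ck_on_open_SucI[OF o])
    show "(norm has_derivative (\<lambda>v. inverse (norm x) * (x \<bullet> v))) (at x)" if "x \<in> - {0}" for x :: 'a
    proof -
      have "(norm has_derivative (\<lambda>v. v \<bullet> sgn x)) (at x)"
        using has_derivative_norm that by auto
      then show ?thesis
        by (simp add: sgn_div_norm inner_commute)
    qed
    have "Ck_on_open k (- {0}) (\<lambda>x::'a. inverse (norm x))"
      by (rule Ck_on_open_compose[OF o _ Suc Ck_on_open_inverse]) auto
    then show "Ck_on_open k (- {0}) (\<lambda>x. inverse (norm x) * (x \<bullet> v))" for v :: 'a
      by (rule Ck_on_open_bilinear[OF o bounded_bilinear_mult _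
            Ck_on_open_bounded_linear[OF o bounded_linear_inner_left]])
  qed
qed

section \<open>Smoothness on arbitrary subsets\<close>

lemma smooth_onI_open:
  assumes "open S" "\<And>k. Ck_on_open k S f"
  shows "smooth_on S f"
  unfolding smooth_on_def using assms by blast

lemma smooth_onE:
  assumes "smooth_on S f" "x \<in> S"
  obtains U h where "open U" "x \<in> U" "\<And>k. Ck_on_open k U h" "\<And>y. y \<in> U \<Longrightarrow> y \<in> S \<Longrightarrow> h y = f y"
proof -
  have "\<exists>U h. open U \<and> x \<in> U \<and> (\<forall>k. Ck_on_open k U h) \<and> (\<forall>y\<in>U \<inter> S. h y = f y)"
    using assms unfolding smooth_on_def by (rule bspec)
  then show thesis
    using that by (metis IntI)
qed

lemma smooth_on_cong:
  assumes "smooth_on S f" "\<And>x. x \<in> S \<Longrightarrow> f x = g x"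
  shows "smooth_on S g"
  unfolding smooth_on_def
proof
  fix x assume "x \<in> S"
  then obtain U h where "open U" "x \<in> U" "\<And>k. Ck_on_open k U h" "\<And>y. y \<in> U \<Longrightarrow> y \<in> S \<Longrightarrow> h y = f y"
    using smooth_onE[OF assms(1)] by blast
  then show "\<exists>U h. open U \<and> x \<in> U \<and> (\<forall>k. Ck_on_open k U h) \<and> (\<forall>y\<in>U \<inter> S. h y = g y)"
    using assms(2) by (intro exI[of _ U] exI[of _ h]) auto
qed

lemma smooth_on_subset:
  assumes "smooth_on S f" "T \<subseteq> S"
  shows "smooth_on T f"
  unfolding smooth_on_def
proof
  fix x assume "x \<in> T"
  then obtain U h where "open U" "x \<in> U" "\<And>k. Ck_on_open k U h" "\<And>y. y \<in> U \<Longrightarrow> y \<in> S \<Longrightarrow> h y = f y"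
    using smooth_onE[OF assms(1)] assms(2) by blast
  then show "\<exists>U h. open U \<and> x \<in> U \<and> (\<forall>k. Ck_on_open k U h) \<and> (\<forall>y\<in>U \<inter> T. h y = f y)"
    using assms(2) by (intro exI[of _ U] exI[of _ h]) auto
qed

lemma smooth_on_local:
  assumes "\<And>x. x \<in> S \<Longrightarrow> \<exists>W. open W \<and> x \<in> W \<and> smooth_on (S \<inter> W) f"
  shows "smooth_on S f"
  unfolding smooth_on_def
proof
  fix x assume x: "x \<in> S"
  then obtain W where W: "open W" "x \<in> W" "smooth_on (S \<inter> W) f"
    using assms by blast
  then obtain U h where U: "open U" "x \<in> U" "\<And>k. Ck_on_open k U h" "\<And>y. y \<in> U \<Longrightarrow> y \<in> (S \<inter> W) \<Longrightarrow> h y = f y"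
    using smooth_onE[OF W(3)] x by blast
  then show "\<exists>U h. open U \<and> x \<in> U \<and> (\<forall>k. Ck_on_open k U h) \<and> (\<forall>y\<in>U \<inter> S. h y = f y)"
    using W by (intro exI[of _ "U \<inter> W"] exI[of _ h]) (auto intro: Ck_on_open_subset)
qed

lemma smooth_on_imp_continuous_on:
  assumes "smooth_on S f"
  shows "continuous_on S f"
  unfolding continuous_on_eq_continuous_within
proof
  fix x assume x: "x \<in> S"
  then obtain U h where U: "open U" "x \<in> U" "\<And>k. Ck_on_open k U h" "\<And>y. y \<in> U \<Longrightarrow> y \<in> S \<Longrightarrow> h y = f y"
    using smooth_onE[OF assms(1)] by metis
  have "continuous_on (S \<inter> U) h"
    using U(3)[of 0] by (auto intro: continuous_on_subset)
  then have "continuous_on (S \<inter> U) f"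
    by (rule continuous_on_eq) (use U(4) in auto)
  then have "continuous (at x within S \<inter> U) f"
    using x U(2) by (simp add: continuous_on_eq_continuous_within)
  then show "continuous (at x within S) f"
    using at_within_nhd[of x U S "S \<inter> U"] U(1,2) by (simp only: continuous_within) simp
qed

lemma smooth_on_compose:
  assumes "smooth_on S f" "smooth_on R g" "f ` S \<subseteq> R"
  shows "smooth_on S (\<lambda>x. g (f x))"
  unfolding smooth_on_def
proof
  fix x assume x: "x \<in> S"
  then obtain U h where U: "open U" "x \<in> U" "\<And>k. Ck_on_open k U h" "\<And>y. y \<in> U \<Longrightarrow> y \<in> S \<Longrightarrow> h y = f y"
    using smooth_onE[OF assms(1)] by metis
  obtain V j where V: "open V" "f x \<in> V" "\<And>k. Ck_on_open k V j" "\<And>y. y \<in> V \<Longrightarrow> y \<in> R \<Longrightarrow> j y = g y"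
    using smooth_onE[OF assms(2), of "f x"] assms(3) x by (metis image_subset_iff)
  \<comment> \<open>The local extension \<open>h\<close> of \<open>f\<close> may leave the domain
    \<open>V\<close> of the extension \<open>j\<close> of \<open>g\<close> even on \<open>U\<close>,
    so the neighbourhood is shrunk to where the composite is defined.\<close>
  let ?W = "U \<inter> h -` V"
  have "open ?W"
    using continuous_on_open_vimage[OF U(1)] Ck_on_open_imp_continuous_on U(3) V(1)
    by (metis Int_commute)
  moreover have "Ck_on_open k ?W (\<lambda>x. j (h x))" for k
    by (rule Ck_on_open_compose[OF \<open>open ?W\<close> V(1) Ck_on_open_subset[OF U(3)] V(3)]) auto
  ultimately show "\<exists>U h. open U \<and> x \<in> U \<and> (\<forall>k. Ck_on_open k U h) \<and> (\<forall>y\<in>U \<inter> S. h y = g (f y))"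
    using U V x assms(3) by (intro exI[of _ ?W] exI[of _ "\<lambda>x. j (h x)"]) auto
qed

lemma smooth_on_bounded_linear: "bounded_linear f \<Longrightarrow> smooth_on S f"
  by (rule smooth_on_subset[OF smooth_onI_open[of UNIV]]) (auto intro: Ck_on_open_bounded_linear)

lemma smooth_on_const: "smooth_on S (\<lambda>x. c)"
  by (rule smooth_on_subset[OF smooth_onI_open[of UNIV]]) (auto intro: Ck_on_open_const)

lemma smooth_on_binop:
  assumes "smooth_on (S :: 'a::euclidean_space set) f" "smooth_on S g"
    and "\<And>k (U :: 'a set) f g. open U \<Longrightarrow> Ck_on_open k U f \<Longrightarrow> Ck_on_open k U g \<Longrightarrow> Ck_on_open k U (\<lambda>x. b (f x) (g x))"
  shows "smooth_on S (\<lambda>x. b (f x) (g x))"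
  unfolding smooth_on_def
proof
  fix x assume x: "x \<in> S"
  obtain U h where U: "open U" "x \<in> U" "\<And>k. Ck_on_open k U h" "\<And>y. y \<in> U \<Longrightarrow> y \<in> S \<Longrightarrow> h y = f y"
    using smooth_onE[OF assms(1) x] by metis
  obtain V j where V: "open V" "x \<in> V" "\<And>k. Ck_on_open k V j" "\<And>y. y \<in> V \<Longrightarrow> y \<in> S \<Longrightarrow> j y = g y"
    using smooth_onE[OF assms(2) x] by metis
  have "Ck_on_open k (U \<inter> V) (\<lambda>x. b (h x) (j x))" for k
    by (rule assms(3)[OF open_Int[OF U(1) V(1)] Ck_on_open_subset[OF U(3)] Ck_on_open_subset[OF V(3)]]) auto
  then show "\<exists>W l. open W \<and> x \<in> W \<and> (\<forall>k. Ck_on_open k W l) \<and> (\<forall>y\<in>W \<inter> S. l y = b (f y) (g y))"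
    using U V by (intro exI[of _ "U \<inter> V"] exI[of _ "\<lambda>x. b (h x) (j x)"]) auto
qed

lemma smooth_on_add: "smooth_on S f \<Longrightarrow> smooth_on S g \<Longrightarrow> smooth_on S (\<lambda>x. f x + g x)"
  by (rule smooth_on_binop) (auto intro: Ck_on_open_add)

lemma smooth_on_bilinear:
  "bounded_bilinear b \<Longrightarrow> smooth_on S f \<Longrightarrow> smooth_on S g \<Longrightarrow> smooth_on S (\<lambda>x. b (f x) (g x))"
  by (rule smooth_on_binop) (auto intro: Ck_on_open_bilinear)

lemmas smooth_on_scaleR = smooth_on_bilinear[OF bounded_bilinear_scaleR]
lemmas smooth_on_mult = smooth_on_bilinear[OF bounded_bilinear_mult]

lemma smooth_on_Pair:
  fixes f :: "'a::euclidean_space \<Rightarrow> 'b::euclidean_space" and g :: "'a \<Rightarrow> 'c::euclidean_space"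
  assumes "smooth_on S f" "smooth_on S g"
  shows "smooth_on S (\<lambda>x. (f x, g x))"
proof -
  have l: "bounded_linear (\<lambda>y::'b. (y, 0::'c))" "bounded_linear (\<lambda>y::'c. (0::'b, y))"
    by (intro bounded_linear_Pair bounded_linear_ident bounded_linear_zero)+
  \<comment> \<open>Written as a sum of two linear embeddings, the pair is covered by the rules for
    sums and composition.\<close>
  have "smooth_on S (\<lambda>x. (f x, 0) + (0, g x))"
    using smooth_on_compose[OF assms(1) smooth_on_bounded_linear[OF l(1), of UNIV]]
      smooth_on_compose[OF assms(2) smooth_on_bounded_linear[OF l(2), of UNIV]]
    by (intro smooth_on_add) auto
  then show ?thesis by simp
qed

lemma smooth_on_norm:
  assumes "smooth_on S f" "\<And>x. x \<in> S \<Longrightarrow> f x \<noteq> 0"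
  shows "smooth_on S (\<lambda>x. norm (f x))"
  by (rule smooth_on_compose[OF assms(1) smooth_onI_open[OF _ Ck_on_open_norm]]) (use assms(2) in auto)

lemma smooth_on_sgn:
  fixes f :: "'a::euclidean_space \<Rightarrow> 'b::euclidean_space"
  assumes "smooth_on S f" "\<And>x. x \<in> S \<Longrightarrow> f x \<noteq> 0"
  shows "smooth_on S (\<lambda>x. sgn (f x))"
proof -
  have "smooth_on S (\<lambda>x. inverse (norm (f x)))"
    by (rule smooth_on_compose[OF smooth_on_norm[OF assms] smooth_onI_open[OF _ Ck_on_open_inverse]])
      (use assms(2) in auto)
  then show ?thesis
    unfolding sgn_div_norm by (rule smooth_on_scaleR[OF _ assms(1)])
qed


section \<open>Smooth parametrisations\<close>

lemma continuous_map_compose2: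
  "continuous_map X Y f \<Longrightarrow> continuous_map Y Z g \<Longrightarrow> continuous_map X Z (\<lambda>x. g (f x))"
  using continuous_map_compose[of X Y f Z g] by (simp add: o_def)

text \<open>
  Smoothness of maps between atlases is tested on maps from subsets of Euclidean spaces. These
  compose without mentioning the charts of intermediate spaces.
\<close>

definition plot ::
  "'e::euclidean_space set \<Rightarrow> 'a topology \<Rightarrow> ('a, 'f::euclidean_space) atlas \<Rightarrow> ('e \<Rightarrow> 'a) \<Rightarrow> bool" where
  "plot S Y B p \<longleftrightarrow>
     continuous_map (top_of_set S) Y p \<and> (\<forall>(V, \<psi>)\<in>B. smooth_on {s \<in> S. p s \<in> V} (\<lambda>s. \<psi> (p s)))"

text \<open>The part of being an atlas that testing with plots relies on. It makes no reference to
  model spaces or transition maps, so it covers smooth atlases, the inclusion of a submanifold and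
  product atlases alike.\<close>

definition charted :: "'a topology \<Rightarrow> ('a, 'f) atlas \<Rightarrow> bool" where
  "charted X A \<longleftrightarrow>
     (\<forall>(U, \<phi>)\<in>A. openin X U \<and> inj_on \<phi> U) \<and> topspace X \<subseteq> (\<Union>c\<in>A. fst c)"

lemma plot_continuous: "plot S Y B p \<Longrightarrow> continuous_map (top_of_set S) Y p"
  by (simp add: plot_def)

lemma plot_smooth_on: "plot S Y B p \<Longrightarrow> (V, \<psi>) \<in> B \<Longrightarrow> smooth_on {s \<in> S. p s \<in> V} (\<lambda>s. \<psi> (p s))"
  by (auto simp: plot_def)

lemma plot_mem: "plot S Y B p \<Longrightarrow> s \<in> S \<Longrightarrow> p s \<in> topspace Y"
  by (auto simp: plot_def continuous_map_def)

lemma plotI: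
  assumes "continuous_map (top_of_set S) Y p"
    and "\<And>V \<psi>. (V, \<psi>) \<in> B \<Longrightarrow> smooth_on {s \<in> S. p s \<in> V} (\<lambda>s. \<psi> (p s))"
  shows "plot S Y B p"
  using assms by (auto simp: plot_def)

lemma plot_cong:
  assumes "plot S Y B p" "\<And>s. s \<in> S \<Longrightarrow> p s = q s"
  shows "plot S Y B q"
proof (rule plotI)
  show "continuous_map (top_of_set S) Y q"
    by (rule continuous_map_eq[OF plot_continuous[OF assms(1)]]) (use assms(2) in auto)
  fix V \<psi> assume "(V, \<psi>) \<in> B"
  moreover have "{s \<in> S. p s \<in> V} = {s \<in> S. q s \<in> V}"
    using assms(2) by auto
  ultimately have "smooth_on {s \<in> S. q s \<in> V} (\<lambda>s. \<psi> (p s))"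
    using plot_smooth_on[OF assms(1)] by metis
  then show "smooth_on {s \<in> S. q s \<in> V} (\<lambda>s. \<psi> (q s))"
    by (rule smooth_on_cong) (use assms(2) in auto)
qed

lemma plot_precompose:
  assumes "plot S Y B p" "smooth_on R f" "f ` R \<subseteq> S"
  shows "plot R Y B (\<lambda>x. p (f x))"
proof (rule plotI)
  have "continuous_map (top_of_set R) (top_of_set S) f"
    using smooth_on_imp_continuous_on[OF assms(2)] assms(3)
    by (auto simp: continuous_map_in_subtopology)
  then show "continuous_map (top_of_set R) Y (\<lambda>x. p (f x))"
    by (rule continuous_map_compose2[OF _ plot_continuous[OF assms(1)]])
  fix V \<psi> assume V: "(V, \<psi>) \<in> B"
  show "smooth_on {s \<in> R. p (f s) \<in> V} (\<lambda>s. \<psi> (p (f s)))"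
    by (rule smooth_on_compose[OF smooth_on_subset[OF assms(2)] plot_smooth_on[OF assms(1) V]])
      (use assms(3) in auto)
qed

lemma plot_subset: "plot S Y B p \<Longrightarrow> R \<subseteq> S \<Longrightarrow> plot R Y B p"
  using plot_precompose[of S Y B p R "\<lambda>x. x"] smooth_on_bounded_linear[OF bounded_linear_ident]
  by auto

text \<open>Continuity and smoothness are both local on the parameter set. This allows a map given
  by different formulas on overlapping open regions to be treated region by region.\<close>

lemma plot_local:
  assumes "\<And>s. s \<in> S \<Longrightarrow> \<exists>W. open W \<and> s \<in> W \<and> plot (S \<inter> W) Y B p"
  shows "plot S Y B p"
proof -
  obtain W where W: "\<And>s. s \<in> S \<Longrightarrow> open (W s) \<and> s \<in> W s \<and> plot (S \<inter> W s) Y B p"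
    using assms by metis
  show ?thesis
  proof (rule plotI)
    show "continuous_map (top_of_set S) Y p"
    proof (rule pasting_lemma[where I=S and T="\<lambda>s. S \<inter> W s" and f="\<lambda>_. p"])
      fix s assume s: "s \<in> S"
      show "openin (top_of_set S) (S \<inter> W s)"
        using W[OF s] by (simp add: openin_open_Int)
      have "continuous_map (top_of_set (S \<inter> W s)) Y p"
        using W[OF s] plot_continuous by blast
      then show "continuous_map (subtopology (top_of_set S) (S \<inter> W s)) Y p"
        by (simp add: subtopology_subtopology Int_assoc[symmetric])
    next
      fix s assume "s \<in> topspace (top_of_set S)"
      then have "s \<in> S" "s \<in> W s"
        using W by auto
      then show "\<exists>j. j \<in> S \<and> s \<in> S \<inter> W j \<and> p s = p s"
        by blast
    qed (rule refl)
    fix V \<psi> assume V: "(V, \<psi>) \<in> B"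
    show "smooth_on {s \<in> S. p s \<in> V} (\<lambda>s. \<psi> (p s))"
    proof (rule smooth_on_local)
      fix s assume s: "s \<in> {s \<in> S. p s \<in> V}"
      have "plot (S \<inter> W s) Y B p"
        using W s by blast
      moreover have "{r \<in> S \<inter> W s. p r \<in> V} = {r \<in> S. p r \<in> V} \<inter> W s"
        by auto
      ultimately have "smooth_on ({r \<in> S. p r \<in> V} \<inter> W s) (\<lambda>s. \<psi> (p s))"
        using plot_smooth_on[OF _ V] by metis
      then show "\<exists>Wa. open Wa \<and> s \<in> Wa \<and> smooth_on ({s \<in> S. p s \<in> V} \<inter> Wa) (\<lambda>s. \<psi> (p s))"
        using W s by blast
    qed
  qed
qed

text \<open>Supplies neighbourhoods in the form \<open>S \<inter> W\<close> with \<open>W\<close>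
  open in the ambient space, as \<open>smooth_on_local\<close> and \<open>plot_local\<close> expect
  them.\<close>

lemma plot_openin_preimage:
  assumes "plot S Y B p" "openin Y V"
  obtains W where "open W" "{s \<in> S. p s \<in> V} = S \<inter> W"
proof -
  have "openin (top_of_set S) {s \<in> S. p s \<in> V}"
    using openin_continuous_map_preimage[OF plot_continuous[OF assms(1)] assms(2)] by simp
  then show thesis
    using that by (auto simp: openin_open)
qed

text \<open>The chart of \<open>X\<close> at the image point only serves to express \<open>f\<close> in coordinates.\<close>

lemma plot_smooth_map:
  assumes p: "plot S X A p" and f: "smooth_map X A Y B f" and "charted X A"
  shows "plot S Y B (\<lambda>s. f (p s))"
proof (rule plotI)
  show "continuous_map (top_of_set S) Y (\<lambda>s. f (p s))"
    using f by (intro continuous_map_compose2[OF plot_continuous[OF p]]) (simp add: smooth_map_def)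
  fix V \<psi> assume V: "(V, \<psi>) \<in> B"
  show "smooth_on {s \<in> S. f (p s) \<in> V} (\<lambda>s. \<psi> (f (p s)))"
  proof (rule smooth_on_local)
    fix s assume s: "s \<in> {s \<in> S. f (p s) \<in> V}"
    then have "p s \<in> (\<Union>c\<in>A. fst c)"
      using plot_mem[OF p, of s] assms(3) unfolding charted_def by blast
    then obtain U \<phi> where U: "(U, \<phi>) \<in> A" "p s \<in> U"
      by auto
    have U': "openin X U" "inj_on \<phi> U"
      using assms(3) U(1) by (auto simp: charted_def)
    obtain W where W: "open W" "{s \<in> S. p s \<in> U} = S \<inter> W"
      using plot_openin_preimage[OF p U'(1)] by metis
    have 1: "smooth_on ({s \<in> S. f (p s) \<in> V} \<inter> W) (\<lambda>s. \<phi> (p s))"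
      by (rule smooth_on_subset[OF plot_smooth_on[OF p U(1)]]) (use W in auto)
    have 2: "smooth_on (\<phi> ` {x \<in> U. f x \<in> V}) (\<lambda>y. \<psi> (f (inv_into U \<phi> y)))"
      using f U(1) V by (fastforce simp: smooth_map_def o_def)
    have 3: "p s \<in> U" if "s \<in> S" "s \<in> W" for s
      using W(2) that by auto
    have "smooth_on ({s \<in> S. f (p s) \<in> V} \<inter> W) (\<lambda>s. \<psi> (f (inv_into U \<phi> (\<phi> (p s)))))"
      by (rule smooth_on_compose[OF 1 2]) (use 3 in auto)
    then have "smooth_on ({s \<in> S. f (p s) \<in> V} \<inter> W) (\<lambda>s. \<psi> (f (p s)))"
      by (rule smooth_on_cong) (use 3 U'(2) in \<open>auto simp: inv_into_f_f\<close>)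
    then show "\<exists>W. open W \<and> s \<in> W \<and> smooth_on ({s \<in> S. f (p s) \<in> V} \<inter> W) (\<lambda>s. \<psi> (f (p s)))"
      using W s U(2) by auto
  qed
qed

text \<open>The inverse charts of the source are enough test maps: read in a chart of the target,
  such a composite is exactly the coordinate expression of \<open>f\<close>.\<close>

lemma smooth_map_plotI:
  assumes f: "continuous_map X Y f" and "charted X A"
    and p: "\<And>U \<phi>. (U, \<phi>) \<in> A \<Longrightarrow> plot (\<phi> ` U) Y B (\<lambda>y. f (inv_into U \<phi> y))"
  shows "smooth_map X A Y B f"
  unfolding smooth_map_def
proof (intro conjI f ballI, safe)
  fix U \<phi> V \<psi> assume U: "(U, \<phi>) \<in> A" and V: "(V, \<psi>) \<in> B"
  have "inj_on \<phi> U"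
    using assms(2) U by (auto simp: charted_def)
  then have "\<phi> ` {x \<in> U. f x \<in> V} = {y \<in> \<phi> ` U. f (inv_into U \<phi> y) \<in> V}"
    by (auto simp: inv_into_f_f)
  then show "smooth_on (\<phi> ` {x \<in> U. f x \<in> V}) (\<psi> \<circ> f \<circ> inv_into U \<phi>)"
    using plot_smooth_on[OF p[OF U] V] by (simp add: o_def)
qed

lemma plot_pair:
  assumes p: "plot S X A p" and q: "plot S Y B q"
  shows "plot S (prod_topology X Y) (prod_atlas A B) (\<lambda>s. (p s, q s))"
proof (rule plotI)
  show "continuous_map (top_of_set S) (prod_topology X Y) (\<lambda>s. (p s, q s))"
    by (intro continuous_map_pairedI plot_continuous[OF p] plot_continuous[OF q])
  fix V \<psi> assume "(V, \<psi>) \<in> prod_atlas A B"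
  then obtain V1 \<psi>1 V2 \<psi>2 where V: "V = V1 \<times> V2" "\<psi> = map_prod \<psi>1 \<psi>2" "(V1, \<psi>1) \<in> A" "(V2, \<psi>2) \<in> B"
    by (auto simp: prod_atlas_def)
  have "smooth_on {s \<in> S. (p s, q s) \<in> V} (\<lambda>s. (\<psi>1 (p s), \<psi>2 (q s)))"
    by (intro smooth_on_Pair smooth_on_subset[OF plot_smooth_on[OF p V(3)]]
        smooth_on_subset[OF plot_smooth_on[OF q V(4)]]) (auto simp: V)
  then show "smooth_on {s \<in> S. (p s, q s) \<in> V} (\<lambda>s. \<psi> (p s, q s))"
    by (simp add: V)
qed

text \<open>The only chart is the inclusion, so nothing but ambient smoothness is tested. It serves
  for the sphere and, with \<open>M = UNIV\<close>, for the parameter line of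
  \<open>\<theta>\<close>.\<close>

lemma plot_submanifold_iff:
  "plot S (top_of_set M) (submanifold_atlas M) p \<longleftrightarrow> p ` S \<subseteq> M \<and> smooth_on S p"
proof
  assume p: "plot S (top_of_set M) (submanifold_atlas M) p"
  then have M: "p ` S \<subseteq> M"
    using plot_mem[OF p] by auto
  then have "{s \<in> S. p s \<in> M} = S"
    by auto
  then show "p ` S \<subseteq> M \<and> smooth_on S p"
    using M plot_smooth_on[OF p, of M "\<lambda>x. x"] by (simp add: submanifold_atlas_def)
next
  assume p: "p ` S \<subseteq> M \<and> smooth_on S p"
  then have "{s \<in> S. p s \<in> M} = S"
    by auto
  then show "plot S (top_of_set M) (submanifold_atlas M) p"
    using p smooth_on_imp_continuous_on[of S p]
    by (auto intro!: plotI simp: continuous_map_in_subtopology submanifold_atlas_def)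
qed

lemma charted_submanifold: "charted (top_of_set M) (submanifold_atlas M)"
  by (auto simp: charted_def submanifold_atlas_def)

lemma charted_prod:
  assumes "charted X A" "charted Y B"
  shows "charted (prod_topology X Y) (prod_atlas A B)"
  unfolding charted_def
proof (intro conjI ballI, safe)
  fix U \<phi> assume "(U, \<phi>) \<in> prod_atlas A B"
  then obtain V1 \<psi>1 V2 \<psi>2 where V: "U = V1 \<times> V2" "\<phi> = map_prod \<psi>1 \<psi>2" "(V1, \<psi>1) \<in> A" "(V2, \<psi>2) \<in> B"
    by (auto simp: prod_atlas_def)
  then show "openin (prod_topology X Y) U" "inj_on \<phi> U"
    using assms by (auto simp: charted_def openin_prod_Times_iff intro: map_prod_inj_on)
next
  fix x y assume "(x, y) \<in> topspace (prod_topology X Y)"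
  then have "x \<in> (\<Union>c\<in>A. fst c)" "y \<in> (\<Union>d\<in>B. fst d)"
    using assms unfolding charted_def by auto
  then obtain U \<phi> V \<psi> where UV: "(U, \<phi>) \<in> A" "x \<in> U" "(V, \<psi>) \<in> B" "y \<in> V"
    by auto
  then have "(U \<times> V, map_prod \<phi> \<psi>) \<in> prod_atlas A B"
    unfolding prod_atlas_def by blast
  with UV show "(x, y) \<in> (\<Union>c\<in>prod_atlas A B. fst c)"
    by force
qed

section \<open>Charts and their inverses\<close>

lemma chartsD:
  assumes "(U, \<phi>) \<in> charts Ms X"
  shows "openin X U" "inj_on \<phi> U" "continuous_map (subtopology X U) euclidean \<phi>"
    "continuous_map (top_of_set (\<phi> ` U)) X (inv_into U \<phi>)"
proof -
  have U: "openin X U" and h: "homeomorphic_map (subtopology X U) (top_of_set (\<phi> ` U)) \<phi>"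
    using assms by (auto simp: charts_def)
  have t: "topspace (subtopology X U) = U"
    using openin_subset[OF U] by auto
  show "openin X U" by (fact U)
  show inj: "inj_on \<phi> U"
    using h t by (simp add: homeomorphic_eq_everything_map)
  show "continuous_map (subtopology X U) euclidean \<phi>"
    using h by (simp add: homeomorphic_eq_everything_map continuous_map_in_subtopology)
  obtain g where g: "homeomorphic_maps (subtopology X U) (top_of_set (\<phi> ` U)) \<phi> g"
    using h by (auto simp: homeomorphic_map_maps)
  have "continuous_map (top_of_set (\<phi> ` U)) X g"
    using g by (auto simp: homeomorphic_maps_def continuous_map_in_subtopology)
  then show "continuous_map (top_of_set (\<phi> ` U)) X (inv_into U \<phi>)"
    by (rule continuous_map_eq) (use g inj t in \<open>auto simp: homeomorphic_maps_def inv_into_f_f\<close>)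
qed

lemma charted_smooth_atlas: "smooth_atlas Ms X A \<Longrightarrow> charted X A"
  unfolding smooth_atlas_def charted_def using chartsD(1,2) by (metis (no_types, lifting) case_prodI2 order_refl subsetD)

text \<open>An inverse chart read in another chart is a transition map. This brings Euclidean
  formulas back to the manifold.\<close>

lemma plot_chart:
  assumes "smooth_atlas Ms X A" "(U, \<phi>) \<in> A"
  shows "plot (\<phi> ` U) X A (inv_into U \<phi>)"
proof (rule plotI)
  have U: "(U, \<phi>) \<in> charts Ms X"
    using assms by (auto simp: smooth_atlas_def)
  show "continuous_map (top_of_set (\<phi> ` U)) X (inv_into U \<phi>)"
    by (rule chartsD(4)[OF U])
  fix V \<psi> assume "(V, \<psi>) \<in> A"
  then have "smooth_on (\<phi> ` (U \<inter> V)) (\<lambda>y. \<psi> (inv_into U \<phi> y))"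
    using assms by (force simp: smooth_atlas_def smooth_transition_def o_def)
  moreover have "\<phi> ` (U \<inter> V) = {s \<in> \<phi> ` U. inv_into U \<phi> s \<in> V}"
    using chartsD(2)[OF U] by (auto simp: inv_into_f_f)
  ultimately show "smooth_on {s \<in> \<phi> ` U. inv_into U \<phi> s \<in> V} (\<lambda>s. \<psi> (inv_into U \<phi> s))"
    by simp
qed


section \<open>Extending a sphere action to Euclidean space\<close>

text \<open>The continuous data behind the extension. Smoothness of \<open>\<theta>\<close> and
  \<open>\<beta>\<close> enters later, as hypotheses of \<open>plot_ext\<close> and
  \<open>smooth_action_act_on\<close>, so that the topological case and the smooth case share one
  construction.\<close>

locale contracted_action =
  fixes G :: "('g, 'x) monoid_scheme" (structure)
    and T :: "'g topology"
    and \<theta> :: "real \<Rightarrow> 'g \<Rightarrow> 'g"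
    and \<beta> :: "'g \<Rightarrow> 'v::euclidean_space \<Rightarrow> 'v"
  assumes group: "group G"
    and topspace_T: "topspace T = carrier G"
    and theta_hom: "\<theta> t \<in> hom G G"
    and theta_le_0: "t \<le> 0 \<Longrightarrow> g \<in> carrier G \<Longrightarrow> \<theta> t g = g"
    and theta_ge_1: "1 \<le> t \<Longrightarrow> g \<in> carrier G \<Longrightarrow> \<theta> t g = \<one>"
    and theta_cont: "continuous_map (prod_topology euclideanreal T) T (\<lambda>(t, g). \<theta> t g)"
    and act: "top_action G T (top_of_set (sphere 0 1)) \<beta>"
begin

text \<open>
  The level \<open>(4 |v|\<^sup>2 - 2)\<^sup>2\<close> is at least \<open>1\<close> unless \<open>1/4 < |v|\<^sup>2 < 3/4\<close>, and it takes every
  value in \<open>[0, 1]\<close> for \<open>1/2 \<le> |v|\<^sup>2 \<le> 3/4\<close>. At the origin \<open>\<beta>\<close> is applied to \<open>sgn 0 = 0\<close>, which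
  is not on the sphere, but the factor \<open>norm v\<close> vanishes there.
\<close>

definition level :: "'v \<Rightarrow> real" where
  "level v = (4 * (norm v)\<^sup>2 - 2)\<^sup>2"

definition ext :: "'g \<Rightarrow> 'v \<Rightarrow> 'v" where
  "ext g v = norm v *\<^sub>R \<beta> (\<theta> (level v) g) (sgn v)"

lemma theta_closed: "g \<in> carrier G \<Longrightarrow> \<theta> t g \<in> carrier G"
  using theta_hom by (rule hom_in_carrier)

lemma group_action_beta: "group_action G (sphere 0 1) \<beta>"
  using act by (simp add: top_action_def)

lemma norm_beta: "g \<in> carrier G \<Longrightarrow> norm u = 1 \<Longrightarrow> norm (\<beta> g u) = 1"
  using group_action.element_image[OF group_action_beta, of g u] by simp

lemma beta_one: "norm u = 1 \<Longrightarrow> \<beta> \<one> u = u"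
  using group_action.id_eq_one[OF group_action_beta] by (metis mem_sphere_0 restrict_apply')

lemma beta_mult: "g \<in> carrier G \<Longrightarrow> h \<in> carrier G \<Longrightarrow> norm u = 1 \<Longrightarrow> \<beta> (g \<otimes> h) u = \<beta> g (\<beta> h u)"
  using group_action.composition_rule[OF group_action_beta] by simp

text \<open>Orbits stay on spheres about the origin, hence \<open>level\<close> is constant along
  them; \<open>ext_mult\<close> rests on this.\<close>

lemma norm_ext: "g \<in> carrier G \<Longrightarrow> norm (ext g v) = norm v"
  by (cases "v = 0") (auto simp: ext_def norm_beta theta_closed norm_sgn)

lemma ext_eq_self:
  assumes "g \<in> carrier G" "1 \<le> level v"
  shows "ext g v = v"
  using assms by (cases "v = 0") (auto simp: ext_def theta_ge_1 beta_one norm_sgn sgn_div_norm)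

text \<open>The number \<open>4 * (norm v)\<^sup>2 - 2\<close> is at most -1 in the first case and
  at least 2 in the second; its square is \<open>level v\<close>.\<close>

lemma level_ge_1:
  assumes "norm v \<le> 1/2 \<or> 1 \<le> norm v"
  shows "1 \<le> level v"
proof -
  have "1 \<le> \<bar>4 * (norm v)\<^sup>2 - 2\<bar>"
    using assms
  proof
    assume "norm v \<le> 1/2"
    then have "(norm v)\<^sup>2 \<le> (1/2)\<^sup>2"
      by (intro power_mono) auto
    then show ?thesis
      by (simp add: power2_eq_square)
  next
    assume "1 \<le> norm v"
    then have "1\<^sup>2 \<le> (norm v)\<^sup>2"
      by (intro power_mono) auto
    then show ?thesis
      by simp
  qed
  then show ?thesis
    unfolding level_def using power_mono[of 1 "\<bar>4 * (norm v)\<^sup>2 - 2\<bar>" 2] by simp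
qed

lemma ext_one: "ext \<one> v = v"
proof (cases "v = 0")
  case False
  have "\<theta> t \<one> = \<one>" for t
    using hom_one[OF theta_hom group group] .
  then show ?thesis
    using False by (simp add: ext_def beta_one norm_sgn sgn_div_norm)
qed (simp add: ext_def)

text \<open>\<open>v\<close> and \<open>ext h v\<close> have the same level, so a single
  endomorphism \<open>\<theta> (level v)\<close> acts on both factors and the homomorphism law of
  \<open>\<beta>\<close> applies.\<close>

lemma ext_mult:
  assumes "g \<in> carrier G" "h \<in> carrier G"
  shows "ext (g \<otimes> h) v = ext g (ext h v)"
proof (cases "v = 0")
  case False
  then have u: "norm (sgn v) = 1"
    by (simp add: norm_sgn)
  have "sgn (ext h v) = \<beta> (\<theta> (level v) h) (sgn v)"
    using False norm_beta[OF theta_closed[OF assms(2)] u]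
    by (simp add: ext_def sgn_scaleR sgn_div_norm[of "\<beta> _ _"])
  moreover have "level (ext h v) = level v"
    by (simp add: level_def norm_ext assms)
  moreover have "\<theta> (level v) (g \<otimes> h) = \<theta> (level v) g \<otimes> \<theta> (level v) h"
    using hom_mult[OF theta_hom] assms by blast
  ultimately show ?thesis
    using u by (simp add: ext_def[of _ "ext h v"] norm_ext assms ext_def[of "g \<otimes> h"] beta_mult theta_closed)
qed (simp add: ext_def)

text \<open>\<open>sgn\<close> is discontinuous at the origin, so the formula is used only off the
  origin and is pasted with the projection \<open>snd\<close> on the ball of radius 1/2, where every
  group element acts as the identity.\<close>

lemma continuous_map_ext: "continuous_map (prod_topology T euclidean) euclidean (\<lambda>(g, v). ext g v)"
proof (rule pasting_lemma[where I=UNIV and T="\<lambda>b. topspace T \<times> (if b then - {0} else ball 0 (1/2))"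
      and f="\<lambda>b. if b then \<lambda>(g, v). ext g v else snd"])
  fix b
  show "openin (prod_topology T euclidean) (topspace T \<times> (if b then - {0} else ball 0 (1/2)))"
    by (simp add: openin_prod_Times_iff open_Compl)
  let ?Z = "subtopology (prod_topology T euclidean) (topspace T \<times> - {0::'v})"
  have g: "continuous_map ?Z T fst"
    by (intro continuous_map_from_subtopology continuous_map_fst)
  have v: "continuous_map ?Z (top_of_set (- {0})) snd"
    by (intro continuous_map_into_subtopology continuous_map_from_subtopology continuous_map_snd) auto
  have n: "continuous_map ?Z euclideanreal (\<lambda>z. norm (snd z))"
    by (rule continuous_map_compose2[OF v]) (auto intro!: continuous_intros)
  have l: "continuous_map ?Z euclideanreal (\<lambda>z. level (snd z))"
    by (rule continuous_map_compose2[OF v]) (auto simp: level_def intro!: continuous_intros)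
  have d: "continuous_map ?Z (top_of_set (sphere 0 1)) (\<lambda>z. sgn (snd z))"
    by (rule continuous_map_compose2[OF v])
      (auto simp: continuous_map_in_subtopology norm_sgn intro!: continuous_intros)
  have "continuous_map ?Z T (\<lambda>z. \<theta> (level (snd z)) (fst z))"
    using continuous_map_compose2[OF continuous_map_pairedI[OF l g] theta_cont] by simp
  then have "continuous_map ?Z (top_of_set (sphere 0 1)) (\<lambda>z. \<beta> (\<theta> (level (snd z)) (fst z)) (sgn (snd z)))"
    using continuous_map_compose2[OF continuous_map_pairedI[OF _ d], of T _ _ "\<lambda>(g, x). \<beta> g x"] act
    by (simp add: top_action_def)
  then have b: "continuous_map ?Z euclidean (\<lambda>z. \<beta> (\<theta> (level (snd z)) (fst z)) (sgn (snd z)))"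
    by (rule continuous_map_into_fulltopology)
  have s: "continuous_map (prod_topology euclideanreal euclidean) euclidean (\<lambda>(r, x). r *\<^sub>R (x::'v))"
    by (auto simp: case_prod_unfold intro!: continuous_intros)
  have "continuous_map ?Z euclidean (\<lambda>z. ext (fst z) (snd z))"
    using continuous_map_compose2[OF continuous_map_pairedI[OF n b] s] by (simp add: ext_def)
  then show "continuous_map (subtopology (prod_topology T euclidean) (topspace T \<times> (if b then - {0} else ball 0 (1/2))))
      euclidean (if b then \<lambda>(g, v). ext g v else snd)"
    by (auto simp: case_prod_unfold intro: continuous_map_from_subtopology continuous_map_snd)
next
  fix z assume "z \<in> topspace (prod_topology T (euclidean :: 'v topology))"
  then show "\<exists>j. j \<in> UNIV \<and> z \<in> topspace T \<times> (if j then - {0} else ball 0 (1/2)) \<and>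
      (case z of (g, v) \<Rightarrow> ext g v) = (if j then \<lambda>(g, v). ext g v else snd) z"
    by (cases "snd z = 0") (auto intro!: exI[of _ "snd z \<noteq> 0"] simp: ext_def)
next
  have *: "ext g v = v" if "g \<in> topspace T" "norm v < 1/2" for g v
    using that by (intro ext_eq_self level_ge_1) (auto simp: topspace_T)
  fix i j z
  assume "z \<in> topspace (prod_topology T (euclidean :: 'v topology)) \<inter>
      (topspace T \<times> (if i then - {0} else ball 0 (1/2))) \<inter> (topspace T \<times> (if j then - {0} else ball 0 (1/2)))"
  then show "(if i then \<lambda>(g, v). ext g v else snd) z = (if j then \<lambda>(g, v). ext g v else snd) z"
    using * by (cases i; cases j) auto
qed

text \<open>
  If \<open>g\<close> acts trivially, then \<open>\<theta> t g\<close> runs in the discrete kernel of \<open>\<beta>\<close> from \<open>g\<close> to the identity.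
\<close>

lemma ext_faithful:
  assumes "almost_effective G T (top_of_set (sphere 0 1)) \<beta>"
    and g: "g \<in> carrier G" and fixed: "\<And>v. norm v < 1 \<Longrightarrow> ext g v = v"
  shows "g = \<one>"
proof -
  define K where "K = kernel G (BijGroup (sphere 0 1)) \<beta>"
  have disc: "subtopology T K = discrete_topology K"
    using assms(1) unfolding almost_effective_def Let_def K_def by simp
  have "\<theta> t g \<in> K" if t: "t \<in> {0..1}" for t
  proof -
    \<comment> \<open>The larger of the two radii at which the level is \<open>t\<close>: solving
      \<open>(4 * \<rho>\<^sup>2 - 2)\<^sup>2 = t\<close> with the positive root keeps the squared
      radius between 1/2 and 3/4, inside the open unit ball.\<close>
    define \<rho> where "\<rho> = sqrt ((2 + sqrt t) / 4)"
    have \<rho>2: "\<rho>\<^sup>2 = (2 + sqrt t) / 4"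
      using t by (simp add: \<rho>_def)
    have "sqrt t \<le> 1"
      using t by simp
    then have \<rho>: "0 < \<rho>" "\<rho> < 1"
      using t by (auto simp: \<rho>_def add_pos_nonneg intro: le_less_trans[of _ 1])
    have "\<beta> (\<theta> t g) u = u" if u: "norm u = 1" for u
    proof -
      have "level (\<rho> *\<^sub>R u) = t"
        using \<rho> u t by (simp add: level_def \<rho>2 power_mult_distrib add_divide_distrib)
      then have "\<rho> *\<^sub>R \<beta> (\<theta> t g) u = \<rho> *\<^sub>R u"
        using fixed[of "\<rho> *\<^sub>R u"] \<rho> u by (simp add: ext_def sgn_scaleR sgn_div_norm)
      then show ?thesis
        using \<rho> by simp
    qed
    \<comment> \<open>The unit of \<open>BijGroup\<close> is the identity restricted to the sphere,
      so equality must also hold off the sphere; there extensionality decides.\<close>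
    then have "\<beta> (\<theta> t g) = (\<lambda>x\<in>sphere 0 1. x)"
      using group_action.bij_prop0[OF group_action_beta theta_closed[OF g, of t]]
      by (intro extensionalityI[of _ "sphere 0 1"]) (auto simp: Bij_imp_extensional)
    then show ?thesis
      using theta_closed[OF g] by (simp add: K_def kernel_def BijGroup_def)
  qed
  moreover have "continuous_map (top_of_set {0..1}) T (\<lambda>t. \<theta> t g)"
    using continuous_map_compose2[OF continuous_map_pairedI[of "top_of_set {0..1}" euclideanreal "\<lambda>t. t" T "\<lambda>_. g"] theta_cont] g
    by (simp add: topspace_T)
  ultimately have "continuous_map (top_of_set {0..1}) (discrete_topology K) (\<lambda>t. \<theta> t g)"
    unfolding disc[symmetric] by (intro continuous_map_into_subtopology) auto
  then have "connectedin (discrete_topology K) ((\<lambda>t. \<theta> t g) ` {0..1})"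
    by (rule connectedin_continuous_map_image) (simp add: connectedin_subtopology)
  then obtain a where "(\<lambda>t. \<theta> t g) ` {0..1} \<subseteq> {a}"
    by (auto simp: connectedin_discrete_topology)
  then have "\<theta> 0 g = \<theta> 1 g"
    by (auto simp: image_subset_iff)
  then show ?thesis
    using theta_le_0[of 0 g] theta_ge_1[of 1 g] g by simp
qed

text \<open>Off the origin norm, direction and level are smooth, and \<open>\<theta>\<close> and
  \<open>\<beta>\<close> preserve plots. The group element moves along a plot \<open>p\<close>, so
  no chart of the group has to be chosen.\<close>

lemma plot_ext:
  assumes AT: "charted T A"
    and \<theta>: "smooth_map (prod_topology euclideanreal T) (prod_atlas (submanifold_atlas UNIV) A) T A (\<lambda>(t, g). \<theta> t g)"
    and \<beta>: "smooth_map (prod_topology T (top_of_set (sphere 0 1))) (prod_atlas A (submanifold_atlas (sphere 0 1)))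
      (top_of_set (sphere 0 1)) (submanifold_atlas (sphere 0 1)) (\<lambda>(g, x). \<beta> g x)"
    and p: "plot S T A p" and v: "smooth_on S v" "\<And>s. s \<in> S \<Longrightarrow> v s \<noteq> 0"
  shows "smooth_on S (\<lambda>s. ext (p s) (v s))"
proof -
  have n: "smooth_on S (\<lambda>s. norm (v s))"
    by (rule smooth_on_norm[OF v])
  have "smooth_on S (\<lambda>s. 4 * (norm (v s) * norm (v s)) + - 2)"
    by (intro smooth_on_add smooth_on_mult smooth_on_const n)
  then have l: "smooth_on S (\<lambda>s. level (v s))"
    using smooth_on_mult[of S "\<lambda>s. 4 * (norm (v s) * norm (v s)) + - 2" "\<lambda>s. 4 * (norm (v s) * norm (v s)) + - 2"]
    by (simp add: level_def power2_eq_square)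
  have "plot S euclideanreal (submanifold_atlas UNIV) (\<lambda>s. level (v s))"
    using l plot_submanifold_iff[of S UNIV "\<lambda>s. level (v s)"] by simp
  from plot_smooth_map[OF plot_pair[OF this p] \<theta>]
  have "plot S T A (\<lambda>s. \<theta> (level (v s)) (p s))"
    using charted_prod[OF charted_submanifold[of "UNIV :: real set"] AT] by simp
  moreover have "plot S (top_of_set (sphere 0 1)) (submanifold_atlas (sphere 0 1)) (\<lambda>s. sgn (v s))"
    using smooth_on_sgn[OF v] v(2) by (auto simp: plot_submanifold_iff norm_sgn)
  ultimately have "plot S (top_of_set (sphere 0 1)) (submanifold_atlas (sphere 0 1)) (\<lambda>s. \<beta> (\<theta> (level (v s)) (p s)) (sgn (v s)))"
    using plot_smooth_map[OF plot_pair \<beta>] charted_prod[OF AT charted_submanifold] by fastforce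
  then have "smooth_on S (\<lambda>s. \<beta> (\<theta> (level (v s)) (p s)) (sgn (v s)))"
    by (simp add: plot_submanifold_iff)
  then show ?thesis
    unfolding ext_def by (rule smooth_on_scaleR[OF n])
qed

end


section \<open>Transfer to a manifold\<close>

text \<open>\<open>cball_subset\<close> puts a full Euclidean ball into the chart image, even if
  that image reaches the boundary of a half-space. \<open>Hausdorff\<close> makes the compact
  support closed.\<close>

locale chart_action = contracted_action G T \<theta> \<beta>
  for G :: "('g, 'x) monoid_scheme" (structure)
    and T :: "'g topology"
    and \<theta> :: "real \<Rightarrow> 'g \<Rightarrow> 'g"
    and \<beta> :: "'g \<Rightarrow> 'v::euclidean_space \<Rightarrow> 'v" +
  fixes Ms :: "'v set set"
    and X :: "'m topology"
    and U :: "'m set"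
    and \<phi> :: "'m \<Rightarrow> 'v"
    and a :: 'v
    and r :: real
  assumes Hausdorff: "Hausdorff_space X"
    and chart: "(U, \<phi>) \<in> charts Ms X"
    and r_pos: "0 < r"
    and cball_subset: "cball a r \<subseteq> \<phi> ` U"
begin

definition coord :: "'v \<Rightarrow> 'v" where
  "coord y = (y - a) /\<^sub>R r"

definition ball_act :: "'g \<Rightarrow> 'v \<Rightarrow> 'v" where
  "ball_act g y = a + r *\<^sub>R ext g (coord y)"

text \<open>Restricted to \<open>topspace X\<close> because \<open>group_action\<close> takes values
  in \<open>BijGroup\<close>, whose elements are extensional functions.\<close>

definition act_on :: "'g \<Rightarrow> 'm \<Rightarrow> 'm" where
  "act_on g = (\<lambda>x\<in>topspace X. if x \<in> U then inv_into U \<phi> (ball_act g (\<phi> x)) else x)"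

definition supp :: "'m set" where
  "supp = {x \<in> U. \<phi> x \<in> cball a r}"

lemma coord_ball_act: "coord (ball_act g y) = ext g (coord y)"
  using r_pos by (simp add: coord_def ball_act_def)

lemma coord_inverse: "a + r *\<^sub>R coord y = y"
  using r_pos by (simp add: coord_def)

lemma ball_act_eq_self: "g \<in> carrier G \<Longrightarrow> 1 \<le> level (coord y) \<Longrightarrow> ball_act g y = y"
  by (simp add: ball_act_def ext_eq_self coord_inverse)

lemma norm_coord: "norm (coord y) = dist a y / r"
  using r_pos by (simp add: coord_def dist_norm norm_minus_commute divide_inverse_commute)

lemma ball_act_outside: "g \<in> carrier G \<Longrightarrow> y \<notin> cball a r \<Longrightarrow> ball_act g y = y"
  using r_pos by (intro ball_act_eq_self level_ge_1) (auto simp: norm_coord field_simps)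

lemma ball_act_cball:
  assumes "g \<in> carrier G" "y \<in> cball a r"
  shows "ball_act g y \<in> cball a r"
proof -
  have "norm (coord (ball_act g y)) = norm (coord y)"
    by (simp add: coord_ball_act norm_ext assms)
  then show ?thesis
    using assms(2) r_pos by (simp add: norm_coord)
qed

text \<open>The ball is mapped to itself and all other points are fixed, so every set containing the
  ball is preserved. The inverse chart can therefore be applied to the result.\<close>

lemma ball_act_image:
  assumes "g \<in> carrier G" "y \<in> \<phi> ` U"
  shows "ball_act g y \<in> \<phi> ` U"
  using ball_act_cball[OF assms(1)] ball_act_outside[OF assms(1)] cball_subset assms(2)
  by (cases "y \<in> cball a r") auto

lemma ball_act_one: "ball_act \<one> y = y"
  by (simp add: ball_act_def ext_one coord_inverse)

lemma ball_act_mult: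
  "g \<in> carrier G \<Longrightarrow> h \<in> carrier G \<Longrightarrow> ball_act (g \<otimes> h) y = ball_act g (ball_act h y)"
  by (simp add: ball_act_def[of "g \<otimes> h"] ext_mult ball_act_def[of g] coord_ball_act)

section \<open>The action on the manifold\<close>

lemma U_subset: "U \<subseteq> topspace X"
  using chartsD(1)[OF chart] by (rule openin_subset)

lemma inv_phi: "x \<in> U \<Longrightarrow> inv_into U \<phi> (\<phi> x) = x"
  using chartsD(2)[OF chart] by (rule inv_into_f_f)

lemma act_on_U:
  assumes "g \<in> carrier G" "x \<in> U"
  shows "act_on g x \<in> U" "\<phi> (act_on g x) = ball_act g (\<phi> x)"
proof -
  have 1: "act_on g x = inv_into U \<phi> (ball_act g (\<phi> x))"
    using assms U_subset by (auto simp: act_on_def)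
  have 2: "ball_act g (\<phi> x) \<in> \<phi> ` U"
    using ball_act_image assms by simp
  show "act_on g x \<in> U" "\<phi> (act_on g x) = ball_act g (\<phi> x)"
    unfolding 1 using inv_into_into[OF 2] f_inv_into_f[OF 2] by auto
qed

lemma act_on_not_U: "x \<in> topspace X \<Longrightarrow> x \<notin> U \<Longrightarrow> act_on g x = x"
  by (simp add: act_on_def)

lemma act_on_eq_self:
  assumes "g \<in> carrier G" "x \<in> U" "1 \<le> level (coord (\<phi> x))"
  shows "act_on g x = x"
  using assms U_subset by (auto simp: act_on_def ball_act_eq_self inv_phi)

lemma act_on_outside:
  assumes "g \<in> carrier G" "x \<in> topspace X" "x \<notin> supp"
  shows "act_on g x = x"
  using assms by (auto simp: act_on_def supp_def ball_act_outside inv_phi)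

lemma act_on_closed: "g \<in> carrier G \<Longrightarrow> x \<in> topspace X \<Longrightarrow> act_on g x \<in> topspace X"
  using act_on_U(1) act_on_not_U U_subset by (cases "x \<in> U") auto

lemma act_on_one: "x \<in> topspace X \<Longrightarrow> act_on \<one> x = x"
  by (simp add: act_on_def ball_act_one inv_phi)

lemma act_on_mult:
  assumes "g \<in> carrier G" "h \<in> carrier G" "x \<in> topspace X"
  shows "act_on (g \<otimes> h) x = act_on g (act_on h x)"
proof (cases "x \<in> U")
  case True
  have gh: "g \<otimes> h \<in> carrier G"
    using group assms by (simp add: group.is_monoid monoid.m_closed)
  have "\<phi> (act_on (g \<otimes> h) x) = \<phi> (act_on g (act_on h x))"
    using True assms gh by (simp add: act_on_U ball_act_mult)
  then show ?thesis
    using inj_onD[OF chartsD(2)[OF chart]] act_on_U(1) True assms gh by blast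
qed (use assms act_on_not_U in simp)

lemma act_on_inv:
  assumes "g \<in> carrier G" "x \<in> topspace X"
  shows "act_on (inv g) (act_on g x) = x" "act_on g (act_on (inv g) x) = x"
  using act_on_mult[of "inv g" g x] act_on_mult[of g "inv g" x] assms
  by (simp_all add: group group.inv_closed group.l_inv group.r_inv act_on_one)

lemma act_on_Bij:
  assumes "g \<in> carrier G"
  shows "act_on g \<in> Bij (topspace X)"
proof -
  have "inv g \<in> carrier G"
    using assms group by (simp add: group.inv_closed)
  then have "bij_betw (act_on g) (topspace X) (topspace X)"
    using assms act_on_closed act_on_inv
    by (intro bij_betwI[where g="act_on (inv g)"]) auto
  moreover have "act_on g \<in> extensional (topspace X)"
    unfolding act_on_def by (rule restrict_extensional)
  ultimately show ?thesis
    by (simp add: Bij_def)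
qed

lemma group_action_act_on: "group_action G (topspace X) act_on"
proof -
  have "act_on (g \<otimes> h) = compose (topspace X) (act_on g) (act_on h)"
    if "g \<in> carrier G" "h \<in> carrier G" for g h
  proof (rule extensionalityI[of _ "topspace X"])
    show "act_on (g \<otimes> h) \<in> extensional (topspace X)"
      unfolding act_on_def by (rule restrict_extensional)
    show "act_on (g \<otimes> h) x = compose (topspace X) (act_on g) (act_on h) x" if "x \<in> topspace X" for x
      using that \<open>g \<in> carrier G\<close> \<open>h \<in> carrier G\<close> by (simp add: compose_def act_on_mult)
  qed (rule compose_extensional)
  then have "act_on \<in> hom G (BijGroup (topspace X))"
    by (auto simp: hom_def BijGroup_def act_on_Bij)
  then show ?thesis
    by (simp add: group_action_def group_hom_def group_hom_axioms_def group group_BijGroup)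
qed

text \<open>Continuity of the chart gives closedness relative to \<open>U\<close> only. Closedness
  in \<open>X\<close> holds because \<open>supp\<close> is the image of a compact ball under the
  inverse chart.\<close>

lemma closedin_supp: "closedin X supp"
proof -
  have "compactin (top_of_set (\<phi> ` U)) (cball a r)"
    using cball_subset by (simp add: compactin_subtopology)
  then have "compactin X (inv_into U \<phi> ` cball a r)"
    by (rule image_compactin[OF _ chartsD(4)[OF chart]])
  moreover have "inv_into U \<phi> ` cball a r = supp"
  proof
    show "inv_into U \<phi> ` cball a r \<subseteq> supp"
      using cball_subset by (auto simp: supp_def inv_into_into f_inv_into_f subset_iff)
    show "supp \<subseteq> inv_into U \<phi> ` cball a r"
      using inv_phi by (force simp: supp_def)
  qed
  ultimately show ?thesis
    using compactin_imp_closedin[OF Hausdorff] by simp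
qed

text \<open>The chart domain and the complement of the closed set \<open>supp\<close> are open and
  cover \<open>X\<close>. On the second the action is the projection, and on the overlap both
  descriptions agree.\<close>

lemma continuous_map_act_on: "continuous_map (prod_topology T X) X (\<lambda>(g, x). act_on g x)"
proof (rule pasting_lemma[where I=UNIV and T="\<lambda>b. topspace T \<times> (if b then U else topspace X - supp)"
      and f="\<lambda>b. if b then \<lambda>(g, x). act_on g x else snd"])
  fix b
  show "openin (prod_topology T X) (topspace T \<times> (if b then U else topspace X - supp))"
    using chartsD(1)[OF chart] closedin_supp by (simp add: openin_prod_Times_iff openin_diff)
  let ?Z = "subtopology (prod_topology T X) (topspace T \<times> U)"
  have g: "continuous_map ?Z T fst"
    by (intro continuous_map_from_subtopology continuous_map_fst)
  have "continuous_map ?Z (subtopology X U) snd"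
    by (intro continuous_map_into_subtopology continuous_map_from_subtopology continuous_map_snd) auto
  then have "continuous_map ?Z euclidean (\<lambda>z. \<phi> (snd z))"
    by (rule continuous_map_compose2[OF _ chartsD(3)[OF chart]])
  then have "continuous_map ?Z euclidean (\<lambda>z. coord (\<phi> (snd z)))"
    by (rule continuous_map_compose2) (auto simp: coord_def intro!: continuous_intros)
  from continuous_map_compose2[OF continuous_map_pairedI[OF g this] continuous_map_ext]
  have "continuous_map ?Z euclidean (\<lambda>z. ext (fst z) (coord (\<phi> (snd z))))"
    by simp
  then have "continuous_map ?Z euclidean (\<lambda>z. ball_act (fst z) (\<phi> (snd z)))"
    unfolding ball_act_def
    by (rule continuous_map_compose2[where g="\<lambda>w. a + r *\<^sub>R w"]) (auto intro!: continuous_intros)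
  then have "continuous_map ?Z (top_of_set (\<phi> ` U)) (\<lambda>z. ball_act (fst z) (\<phi> (snd z)))"
    by (rule continuous_map_into_subtopology) (auto simp: topspace_T ball_act_image)
  then have "continuous_map ?Z X (\<lambda>z. inv_into U \<phi> (ball_act (fst z) (\<phi> (snd z))))"
    by (rule continuous_map_compose2[OF _ chartsD(4)[OF chart]])
  then have "continuous_map ?Z X (\<lambda>(g, x). act_on g x)"
    by (rule continuous_map_eq) (use U_subset in \<open>auto simp: act_on_def\<close>)
  then show "continuous_map (subtopology (prod_topology T X) (topspace T \<times> (if b then U else topspace X - supp)))
      X (if b then \<lambda>(g, x). act_on g x else snd)"
    by (auto intro: continuous_map_from_subtopology continuous_map_snd)
next
  fix z assume "z \<in> topspace (prod_topology T X)"
  then show "\<exists>j. j \<in> UNIV \<and> z \<in> topspace T \<times> (if j then U else topspace X - supp) \<and>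
      (case z of (g, x) \<Rightarrow> act_on g x) = (if j then \<lambda>(g, x). act_on g x else snd) z"
    by (cases "snd z \<in> U") (auto intro!: exI[of _ "snd z \<in> U"] simp: act_on_not_U supp_def)
next
  fix i j z
  assume "z \<in> topspace (prod_topology T X) \<inter>
      (topspace T \<times> (if i then U else topspace X - supp)) \<inter> (topspace T \<times> (if j then U else topspace X - supp))"
  then show "(if i then \<lambda>(g, x). act_on g x else snd) z = (if j then \<lambda>(g, x). act_on g x else snd) z"
    using act_on_outside topspace_T by (cases i; cases j) auto
qed

lemma top_action_act_on: "top_action G T X act_on"
proof -
  have cont: "continuous_map X X (act_on g)" if "g \<in> carrier G" for g
    using continuous_map_compose2[OF continuous_map_pairedI[of X T "\<lambda>_. g" X "\<lambda>x. x"] continuous_map_act_on] that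
    by (simp add: topspace_T)
  have "homeomorphic_map X X (act_on g)" if "g \<in> carrier G" for g
  proof -
    have "inv g \<in> carrier G"
      using that group by (simp add: group.inv_closed)
    then have "homeomorphic_maps X X (act_on g) (act_on (inv g))"
      using that by (simp add: homeomorphic_maps_def cont act_on_inv)
    then show ?thesis
      by (rule homeomorphic_maps_map[THEN iffD1, THEN conjunct1])
  qed
  then show ?thesis
    by (simp add: top_action_def group_action_act_on continuous_map_act_on)
qed

lemma identity_outside_act_on: "identity_outside G X act_on supp"
  by (simp add: identity_outside_def act_on_outside)

lemma coordinate_ball_supp: "(U, \<phi>) \<in> C \<Longrightarrow> coordinate_ball C supp"
  unfolding coordinate_ball_def supp_def using r_pos cball_subset by blast

text \<open>Every vector of the open unit ball is the rescaled coordinate of a point of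
  \<open>U\<close>, so an element acting trivially on \<open>X\<close> satisfies the hypothesis of
  \<open>ext_faithful\<close>.\<close>

lemma effective_act_on:
  assumes "almost_effective G T (top_of_set (sphere 0 1)) \<beta>"
  shows "effective G X act_on"
proof -
  have "g = \<one>" if g: "g \<in> carrier G" and 1: "act_on g = (\<lambda>x\<in>topspace X. x)" for g
  proof (rule ext_faithful[OF assms g])
    fix v :: 'v assume "norm v < 1"
    then have "a + r *\<^sub>R v \<in> cball a r"
      using r_pos by (simp add: dist_norm)
    then obtain x where x: "x \<in> U" "\<phi> x = a + r *\<^sub>R v"
      using cball_subset by (metis imageE subsetD)
    have "coord (\<phi> x) = v"
      using r_pos by (simp add: coord_def x)
    moreover have "ball_act g (\<phi> x) = \<phi> x"
      using act_on_U(2)[OF g x(1)] 1 x(1) U_subset by auto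
    ultimately show "ext g v = v"
      by (metis coord_ball_act)
  qed
  moreover have "act_on \<one> = (\<lambda>x\<in>topspace X. x)"
    using group_action.id_eq_one[OF group_action_act_on] by simp
  ultimately show ?thesis
    using group by (auto simp: effective_def kernel_def BijGroup_def group.is_monoid)
qed

lemma smooth_action_act_on:
  assumes AT: "smooth_atlas Ns T A"
    and \<theta>: "smooth_map (prod_topology euclideanreal T) (prod_atlas (submanifold_atlas UNIV) A) T A (\<lambda>(t, g). \<theta> t g)"
    and \<beta>: "smooth_map (prod_topology T (top_of_set (sphere 0 1))) (prod_atlas A (submanifold_atlas (sphere 0 1)))
      (top_of_set (sphere 0 1)) (submanifold_atlas (sphere 0 1)) (\<lambda>(g, x). \<beta> g x)"
    and AM: "smooth_atlas Ms X AM" "(U, \<phi>) \<in> AM"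
  shows "smooth_action G T A X AM act_on"
proof -
  note cT = charted_smooth_atlas[OF AT] and cX = charted_smooth_atlas[OF AM(1)]
  \<comment> \<open>Smoothness is proved along arbitrary plots in both arguments; below, the plots
    are the components of an inverse product chart.\<close>
  have *: "plot S X AM (\<lambda>s. act_on (p s) (q s))" if p: "plot S T A p" and q: "plot S X AM q" for S p q
  proof (rule plot_local)
    fix s assume s: "s \<in> S"
    have pG: "p s \<in> carrier G" if "s \<in> S" for s
      using plot_mem[OF p that] topspace_T by simp
    obtain W1 where W1: "open W1" "{s \<in> S. q s \<in> topspace X - supp} = S \<inter> W1"
      using plot_openin_preimage[OF q openin_diff[OF openin_topspace closedin_supp]] by metis
    obtain W2 where W2: "open W2" "{s \<in> S. q s \<in> U} = S \<inter> W2"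
      using plot_openin_preimage[OF q chartsD(1)[OF chart]] by metis
    have qU: "q s \<in> U" if "s \<in> S" "s \<in> W2" for s
      using that W2(2) by auto
    have q2: "plot (S \<inter> W2) X AM q"
      by (rule plot_subset[OF q]) auto
    have sq: "smooth_on (S \<inter> W2) (\<lambda>s. \<phi> (q s))"
      by (rule smooth_on_subset[OF plot_smooth_on[OF q AM(2)]]) (use W2 in auto)
    have sv: "smooth_on (S \<inter> W2) (\<lambda>s. coord (\<phi> (q s)))"
    proof -
      have "smooth_on (S \<inter> W2) (\<lambda>s. inverse r *\<^sub>R (\<phi> (q s) + - a))"
        by (rule smooth_on_scaleR[OF smooth_on_const smooth_on_add[OF sq smooth_on_const]])
      then show ?thesis
        by (simp add: coord_def)
    qed
    \<comment> \<open>Conditions on the coordinate are open relative to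
      \<open>S \<inter> W2\<close>, where the chart is defined; intersecting with \<open>W2\<close>
      makes them open relative to \<open>S\<close>.\<close>
    have ex: "\<exists>W. open W \<and> {s \<in> S. q s \<in> U \<and> coord (\<phi> (q s)) \<in> N} = S \<inter> W" if "open N" for N
    proof -
      have "openin (top_of_set (S \<inter> W2)) ((S \<inter> W2) \<inter> (\<lambda>s. coord (\<phi> (q s))) -` N)"
        using continuous_openin_preimage_gen[OF smooth_on_imp_continuous_on[OF sv] that] .
      then obtain W where "open W" "(S \<inter> W2) \<inter> (\<lambda>s. coord (\<phi> (q s))) -` N = (S \<inter> W2) \<inter> W"
        by (auto simp: openin_open)
      then show ?thesis
        using W2 by (intro exI[of _ "W2 \<inter> W"]) auto
    qed
    \<comment> \<open>Three open conditions that cover all cases: in the first two the action is the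
      identity and the plot \<open>q\<close> is unchanged; the third avoids the centre of the ball,
      so \<open>plot_ext\<close> applies.\<close>
    consider "q s \<in> topspace X - supp" | "q s \<in> U" "norm (coord (\<phi> (q s))) < 1/2" | "q s \<in> U" "coord (\<phi> (q s)) \<noteq> 0"
      using plot_mem[OF q s] by (cases "coord (\<phi> (q s)) = 0") (auto simp: supp_def)
    then show "\<exists>W. open W \<and> s \<in> W \<and> plot (S \<inter> W) X AM (\<lambda>s. act_on (p s) (q s))"
    proof cases
      case 1
      have "plot (S \<inter> W1) X AM (\<lambda>s. act_on (p s) (q s))"
      proof (rule plot_cong[OF plot_subset[OF q]])
        fix s assume "s \<in> S \<inter> W1"
        then have "s \<in> S" "q s \<in> topspace X" "q s \<notin> supp"
          using W1(2) by auto
        then show "q s = act_on (p s) (q s)"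
          using act_on_outside[OF pG] by simp
      qed auto
      then show ?thesis
        using W1 1 s by blast
    next
      case 2
      obtain W where W: "open W" "{s \<in> S. q s \<in> U \<and> coord (\<phi> (q s)) \<in> ball 0 (1/2)} = S \<inter> W"
        using ex[of "ball 0 (1/2)"] by auto
      have "plot (S \<inter> W) X AM (\<lambda>s. act_on (p s) (q s))"
      proof (rule plot_cong[OF plot_subset[OF q]])
        fix s assume "s \<in> S \<inter> W"
        then have "s \<in> {s \<in> S. q s \<in> U \<and> coord (\<phi> (q s)) \<in> ball 0 (1/2)}"
          using W(2) by blast
        then have "s \<in> S" "q s \<in> U" "norm (coord (\<phi> (q s))) \<le> 1/2"
          by auto
        then show "q s = act_on (p s) (q s)"
          using act_on_eq_self[OF pG] level_ge_1 by simp
      qed auto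
      moreover have "s \<in> {s \<in> S. q s \<in> U \<and> coord (\<phi> (q s)) \<in> ball 0 (1/2)}"
        using 2 s by simp
      ultimately show ?thesis
        using W by blast
    next
      case 3
      obtain W where W: "open W" "{s \<in> S. q s \<in> U \<and> coord (\<phi> (q s)) \<in> - {0}} = S \<inter> W"
        using ex[of "- {0}"] by auto
      have SW: "s \<in> S" "q s \<in> U" "s \<in> W2" "coord (\<phi> (q s)) \<noteq> 0" if "s \<in> S \<inter> W" for s
      proof -
        have "s \<in> {s \<in> S. q s \<in> U \<and> coord (\<phi> (q s)) \<in> - {0}}"
          using that W(2) by blast
        then show "s \<in> S" "q s \<in> U" "s \<in> W2" "coord (\<phi> (q s)) \<noteq> 0"
          using W2(2) by auto
      qed
      have "smooth_on (S \<inter> W) (\<lambda>s. ext (p s) (coord (\<phi> (q s))))"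
      proof (rule plot_ext[OF cT \<theta> \<beta>])
        show "plot (S \<inter> W) T A p"
          by (rule plot_subset[OF p]) auto
        show "smooth_on (S \<inter> W) (\<lambda>s. coord (\<phi> (q s)))"
          by (rule smooth_on_subset[OF sv]) (use SW in auto)
      qed (use SW in auto)
      then have "smooth_on (S \<inter> W) (\<lambda>s. ball_act (p s) (\<phi> (q s)))"
        unfolding ball_act_def
        by (rule smooth_on_add[OF smooth_on_const smooth_on_scaleR[OF smooth_on_const]])
      \<comment> \<open>A smooth map into the chart image followed by the inverse chart, itself a
        plot, is a plot.\<close>
      then have "plot (S \<inter> W) X AM (\<lambda>s. inv_into U \<phi> (ball_act (p s) (\<phi> (q s))))"
        by (rule plot_precompose[OF plot_chart[OF AM]]) (use SW pG ball_act_image in auto)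
      then have "plot (S \<inter> W) X AM (\<lambda>s. act_on (p s) (q s))"
        by (rule plot_cong) (use SW(2) U_subset in \<open>simp add: act_on_def subset_iff\<close>)
      moreover have "s \<in> {s \<in> S. q s \<in> U \<and> coord (\<phi> (q s)) \<in> - {0}}"
        using 3 s by simp
      ultimately show ?thesis
        using W by blast
    qed
  qed
  have "smooth_map (prod_topology T X) (prod_atlas A AM) X AM (\<lambda>(g, x). act_on g x)"
  proof (rule smooth_map_plotI[OF continuous_map_act_on charted_prod[OF cT cX]])
    fix P \<psi> assume "(P, \<psi>) \<in> prod_atlas A AM"
    then obtain V \<omega> V' \<omega>' where P: "P = V \<times> V'" "\<psi> = map_prod \<omega> \<omega>'" "(V, \<omega>) \<in> A" "(V', \<omega>') \<in> AM"
      by (auto simp: prod_atlas_def)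
    have im: "\<psi> ` P = \<omega> ` V \<times> \<omega>' ` V'"
      unfolding P by (rule map_prod_surj_on) auto
    have inj: "inj_on \<omega> V" "inj_on \<omega>' V'"
      using cT cX P(3,4) by (auto simp: charted_def)
    then have injP: "inj_on \<psi> P"
      unfolding P by (rule map_prod_inj_on)
    have p: "plot (\<psi> ` P) T A (\<lambda>y. inv_into V \<omega> (fst y))"
      by (rule plot_precompose[OF plot_chart[OF AT P(3)] smooth_on_bounded_linear[OF bounded_linear_fst]])
        (auto simp: im)
    have q: "plot (\<psi> ` P) X AM (\<lambda>y. inv_into V' \<omega>' (snd y))"
      by (rule plot_precompose[OF plot_chart[OF AM(1) P(4)] smooth_on_bounded_linear[OF bounded_linear_snd]])
        (auto simp: im)
    \<comment> \<open>\<open>inv_into\<close> chooses some preimage; injectivity of the product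
      chart and of both factors forces the choices to agree.\<close>
    have "inv_into P \<psi> y = (inv_into V \<omega> (fst y), inv_into V' \<omega>' (snd y))" if "y \<in> \<psi> ` P" for y
    proof -
      from that obtain x x' where x: "x \<in> V" "x' \<in> V'" "y = \<psi> (x, x')"
        by (auto simp: P)
      then have "inv_into P \<psi> y = (x, x')"
        using inv_into_f_f[OF injP, of "(x, x')"] by (simp add: P(1))
      then show ?thesis
        using x inj by (simp add: P(2) inv_into_f_f)
    qed
    then show "plot (\<psi> ` P) X AM (\<lambda>y. case inv_into P \<psi> y of (g, x) \<Rightarrow> act_on g x)"
      by (intro plot_cong[OF *[OF p q]]) simp
  qed
  then show ?thesis
    by (simp add: smooth_action_def top_action_act_on)
qed

end

text \<open>A chart image open in a half-space contains no ball about a boundary point. Pushing the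
  point inwards reaches the open half-space, where a Euclidean ball fits.\<close>

lemma boundary_model_chart_cball:
  fixes \<phi> :: "'m \<Rightarrow> real ^ 'n"
  assumes "(U, \<phi>) \<in> charts boundary_models X" "U \<noteq> {}"
  obtains a r where "0 < r" "cball a r \<subseteq> \<phi> ` U"
proof -
  obtain H where H: "H \<in> boundary_models" "openin (top_of_set H) (\<phi> ` U)"
    using assms(1) by (auto simp: charts_def)
  obtain O' where O: "open O'" "\<phi> ` U = H \<inter> O'"
    using H(2) by (auto simp: openin_open)
  obtain y where y: "y \<in> H" "y \<in> O'"
    using O(2) assms(2) by blast
  have "\<exists>N z. open N \<and> N \<subseteq> H \<and> z \<in> N \<inter> O'"
  proof (cases "H = UNIV")
    case True
    then show ?thesis
      using y by blast
  next
    case False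
    then obtain k where k: "H = {x. 0 \<le> x $ k}"
      using H(1) by (auto simp: boundary_models_def)
    obtain e where e: "0 < e" "cball y e \<subseteq> O'"
      using O(1) y(2) open_contains_cball by blast
    \<comment> \<open>The shift along the normal axis has length exactly \<open>e\<close>, hence the
      closed ball; it makes the coordinate \<open>k\<close>, which is at least 0 at
      \<open>y\<close>, strictly positive.\<close>
    have "y + e *\<^sub>R axis k 1 \<in> cball y e"
      using e(1) by (simp add: dist_norm norm_axis_1)
    moreover have "0 < (y + e *\<^sub>R axis k 1) $ k"
      using y(1) e(1) k by simp
    moreover have "open {x :: real ^ 'n. 0 < x $ k}"
      by (intro open_Collect_less continuous_intros)
    ultimately show ?thesis
      using e(2) k by (intro exI[of _ "{x. 0 < x $ k}"] exI[of _ "y + e *\<^sub>R axis k 1"]) auto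
  qed
  then obtain N z where N: "open N" "N \<subseteq> H" "z \<in> N \<inter> O'"
    by blast
  then obtain r where "0 < r" "cball z r \<subseteq> N \<inter> O'"
    using open_contains_cball[of "N \<inter> O'"] O(1) by blast
  then show thesis
    using that N(2) O(2) by blast
qed

theorem theorem3p2:
  fixes G :: "('g, 'x) monoid_scheme"
    and T :: "'g topology"
    and A :: "('g, 'k::euclidean_space) atlas"
    and \<beta> :: "'g \<Rightarrow> real ^ 'n \<Rightarrow> real ^ 'n"
    and X :: "'m topology"
  assumes "lie_group G T A"
    and "connected_space T"
    and "lie_contractible G T A"
    and "smooth_action G T A (top_of_set (sphere 0 1)) (submanifold_atlas (sphere 0 1)) \<beta>"
    and "almost_effective G T (top_of_set (sphere 0 1 :: (real ^ 'n) set)) \<beta>"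
    and "topological_manifold TYPE('n) X"
  shows "(\<exists>\<alpha> B. top_action G T X \<alpha> \<and> effective G X \<alpha> \<and>
            coordinate_ball (charts (boundary_models :: (real ^ 'n) set set) X) B \<and>
            identity_outside G X \<alpha> B) \<and>
         (\<forall>AM :: ('m, real ^ 'n) atlas. smooth_atlas boundary_models X AM \<longrightarrow>
            (\<exists>\<alpha> B. smooth_action G T A X AM \<alpha> \<and> effective G X \<alpha> \<and>
               coordinate_ball (smooth_charts boundary_models X AM) B \<and>
               identity_outside G X \<alpha> B))"
proof -
  obtain \<theta> where \<theta>: "\<And>t. \<theta> t \<in> hom G G" "\<And>t g. t \<le> 0 \<Longrightarrow> g \<in> carrier G \<Longrightarrow> \<theta> t g = g"
      "\<And>t g. 1 \<le> t \<Longrightarrow> g \<in> carrier G \<Longrightarrow> \<theta> t g = \<theta> 1 g"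
      "smooth_map (prod_topology euclideanreal T) (prod_atlas (submanifold_atlas UNIV) A) T A (\<lambda>(t, g). \<theta> t g)"
      "\<And>g. g \<in> carrier G \<Longrightarrow> \<theta> 1 g = \<one>\<^bsub>G\<^esub>"
    using assms(3) unfolding lie_contractible_def by blast
  interpret contracted_action G T \<theta> \<beta>
  proof (rule contracted_action.intro)
    show "group G" "topspace T = carrier G"
      using assms(1) by (auto simp: lie_group_def)
    show "\<theta> t g = \<one>\<^bsub>G\<^esub>" if "1 \<le> t" "g \<in> carrier G" for t g
      using \<theta>(3)[OF that] \<theta>(5)[OF that(2)] by simp
    show "continuous_map (prod_topology euclideanreal T) T (\<lambda>(t, g). \<theta> t g)"
      using \<theta>(4) by (simp add: smooth_map_def)
    show "top_action G T (top_of_set (sphere 0 1)) \<beta>"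
      using assms(4) by (simp add: smooth_action_def)
  qed (use \<theta>(1,2) in auto)
  have X: "Hausdorff_space X" "topspace X \<noteq> {}"
    using assms(6) by (auto simp: topological_manifold_def metrizable_imp_Hausdorff_space)
  obtain x where x: "x \<in> topspace X"
    using X(2) by blast
  show ?thesis
  proof (intro conjI allI impI)
    obtain U \<phi> where U: "(U, \<phi>) \<in> charts (boundary_models :: (real ^ 'n) set set) X" "x \<in> U"
      using assms(6) x unfolding topological_manifold_def by fastforce
    obtain a r where ar: "0 < r" "cball a r \<subseteq> \<phi> ` U"
      by (rule boundary_model_chart_cball[OF U(1)]) (use U(2) in auto)
    interpret chart_action G T \<theta> \<beta> boundary_models X U \<phi> a r
      by unfold_locales (fact X(1) U(1) ar)+
    show "\<exists>\<alpha> B. top_action G T X \<alpha> \<and> effective G X \<alpha> \<and>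
        coordinate_ball (charts (boundary_models :: (real ^ 'n) set set) X) B \<and> identity_outside G X \<alpha> B"
      using top_action_act_on effective_act_on[OF assms(5)] coordinate_ball_supp[OF U(1)]
        identity_outside_act_on by blast
  next
    fix AM :: "('m, real ^ 'n) atlas" assume AM: "smooth_atlas boundary_models X AM"
    then have "x \<in> (\<Union>c\<in>AM. fst c)"
      using x by (simp add: smooth_atlas_def)
    \<comment> \<open>The chart is now taken from the given atlas, so that the action built in it is
      smooth. As the transitions within \<open>AM\<close> are smooth, it also belongs to the maximal
      atlas, which makes the support a smooth coordinate ball.\<close>
    then obtain U \<phi> where U: "(U, \<phi>) \<in> AM" "x \<in> U"
      by auto
    then have ch: "(U, \<phi>) \<in> charts boundary_models X" "(U, \<phi>) \<in> smooth_charts boundary_models X AM"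
      using AM by (auto simp: smooth_atlas_def smooth_charts_def)
    obtain a r where ar: "0 < r" "cball a r \<subseteq> \<phi> ` U"
      by (rule boundary_model_chart_cball[OF ch(1)]) (use U(2) in auto)
    interpret chart_action G T \<theta> \<beta> boundary_models X U \<phi> a r
      by unfold_locales (fact X(1) ch(1) ar)+
    obtain V where "smooth_atlas {V} T A"
      using assms(1) by (auto simp: lie_group_def)
    then have "smooth_action G T A X AM act_on"
      by (rule smooth_action_act_on[OF _ \<theta>(4) _ AM U(1)]) (use assms(4) in \<open>simp add: smooth_action_def\<close>)
    then show "\<exists>\<alpha> B. smooth_action G T A X AM \<alpha> \<and> effective G X \<alpha> \<and>
        coordinate_ball (smooth_charts boundary_models X AM) B \<and> identity_outside G X \<alpha> B"
      using effective_act_on[OF assms(5)] coordinate_ball_supp[OF ch(2)] identity_outside_act_on by blast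
  qed
qed

end
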